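(* Let $f(z)=z+\sum_{n=2}^{\infty}a_nz^n\in\mathcal{C}_2$ and let $N\ge2$ be an integer. Then $$|f(z)|+\sum_{n=N}^{\infty}|a_nz^n|\le d(f(0),\partial f(\mathbb{D}))$$ for $|z|\le r^*_{1,N}$, where $r^*_{1,N}$ is the solution in $(0,1)$ of $$3r+2r^N-1=0.$$ The result is sharp, i.e. for each $N\ge2$ the number $r^*_{1,N}$ cannot be replaced by any larger number such that the inequality still holds for all $f\in\mathcal{C}_2$.
   Context: $\mathbb{D}=\{z\in\mathbb{C}:|z|<1\}$; $d$ is the Euclidean distance and $\partial f(\mathbb{D})$ is the boundary of $f(\mathbb{D})$. A convex function is a univalent analytic function on $\mathbb{D}$ whose image is a convex domain. The class $\mathcal{C}_2$ consists of the analytic functions $f(z)=z+\sum_{n=2}^\infty a_nz^n$ on $\mathbb{D}$ for which there exists a convex function $g(z)=b_1z+\cdots$ with $\operatorname{Re}(b_1)>0$ such that $\operatorname{Re}\left(\frac{(zf'(z))'}{g'(z)}\right)>0$ for all $z\in\mathbb{D}$. *)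

theory Defs
  imports "HOL-Complex_Analysis.Complex_Analysis"
begin

definition convex_function :: "(complex \<Rightarrow> complex) \<Rightarrow> bool" where
  "convex_function g \<longleftrightarrow>
     g holomorphic_on ball 0 1 \<and> inj_on g (ball 0 1) \<and> convex (g ` ball 0 1)"

text \<open>
  The normalisations \<open>f(z) = z + \<Sum>\<^sub>n\<^sub>\<ge>\<^sub>2 a\<^sub>n z\<^sup>n\<close> and \<open>g(z) = b\<^sub>1 z + \<dots>\<close> are expressed through
  the first two Taylor coefficients at 0. Functions are total on the complex numbers, but
  only their values on the unit disc matter.
\<close>

definition class_C2 :: "(complex \<Rightarrow> complex) set" where
  "class_C2 = {f. f holomorphic_on ball 0 1 \<and> f 0 = 0 \<and> deriv f 0 = 1 \<and>
     (\<exists>g. convex_function g \<and> g 0 = 0 \<and> Re (deriv g 0) > 0 \<and>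
        (\<forall>z\<in>ball 0 1. Re (deriv (\<lambda>w. w * deriv f w) z / deriv g z) > 0))}"

definition taylor_coeff :: "(complex \<Rightarrow> complex) \<Rightarrow> nat \<Rightarrow> complex" where
  "taylor_coeff f n = fps_nth (fps_expansion f 0) n"

text \<open>
  For \<open>f\<close> in the class and \<open>z\<close> in the open unit disc the series below
  converges, being a tail of the absolutely convergent Taylor series of \<open>f\<close> at 0.
\<close>

definition bohr_ineq :: "nat \<Rightarrow> (complex \<Rightarrow> complex) \<Rightarrow> complex \<Rightarrow> bool" where
  "bohr_ineq N f z \<longleftrightarrow>
     norm (f z) + (\<Sum>n. norm (taylor_coeff f (n + N) * z ^ (n + N)))
       \<le> infdist (f 0) (frontier (f ` ball 0 1))"

definition is_root :: "nat \<Rightarrow> real \<Rightarrow> bool" where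
  "is_root N r \<longleftrightarrow> 0 < r \<and> r < 1 \<and> 3 * r + 2 * r ^ N - 1 = 0"

definition r_star :: "nat \<Rightarrow> real" where
  "r_star N = (THE r. is_root N r)"

end

theory Submission
  imports Defs
begin

text \<open>
  Write \<open>F z = z f'(z)\<close>, so that \<open>F' = g' p\<close> with \<open>Re p > 0\<close>. The inequality reduces to \<open>|a\<^sub>n| \<le> 1\<close> and
  to the distance from \<open>f 0\<close> to the boundary being at least \<open>1/2\<close>, because then the left-hand side
  is at most \<open>(r + r\<^sup>N) / (1 - r)\<close>, which is \<open>\<le> 1/2\<close> exactly when \<open>3 r + 2 r\<^sup>N \<le> 1\<close>. The function
  \<open>z / (1 - z)\<close> attains equality in both estimates.

  The coefficient bound follows by comparing coefficients in \<open>F' = g' p\<close>, where the coefficients of \<open>g\<close>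
  and \<open>p\<close> are bounded by averaging over roots of unity. For the distance, \<open>F\<close> is injective because
  \<open>F \<circ> g\<^sup>-\<^sup>1\<close> has a derivative of positive real part on a convex domain, and the distortion bounds for \<open>g'\<close>
  and \<open>p\<close> give \<open>|F'(z)| \<ge> (1 - r) / (1 + r)\<^sup>3\<close>. Hence \<open>|F z| \<ge> r / (1 + r)\<^sup>2\<close>, that is
  \<open>|f'(z)| \<ge> 1 / (1 + r)\<^sup>2\<close>, so \<open>f\<close> covers the disc of radius \<open>\<integral>\<^sub>0\<^sup>1 (1 + r)\<^sup>-\<^sup>2 dr = 1/2\<close>. The boundary
  of the range is nonempty by Liouville's theorem, since \<open>f\<close> is close-to-convex and therefore injective.
\<close>

section \<open>Convex functions\<close>

text \<open>Univalence makes the range open and the inverse \<open>\<gamma>\<close> holomorphic. The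
  derivative of \<open>\<gamma>\<close> is recorded at \<open>g z\<close>, the form in which the
  chain rule consumes it.\<close>

lemma convex_function_inverse:
  assumes "convex_function g"
  obtains \<gamma> where "\<gamma> holomorphic_on g ` ball 0 1" "open (g ` ball 0 1)" "convex (g ` ball 0 1)"
    "\<And>z. z \<in> ball 0 1 \<Longrightarrow> \<gamma> (g z) = z"
    "\<And>z. z \<in> ball 0 1 \<Longrightarrow> (\<gamma> has_field_derivative inverse (deriv g z)) (at (g z))"
    "\<And>z. z \<in> ball 0 1 \<Longrightarrow> deriv g z \<noteq> 0"
proof -
  have g: "g holomorphic_on ball 0 1" "inj_on g (ball 0 1)" "convex (g ` ball 0 1)"
    using assms by (auto simp: convex_function_def)
  have op: "open (g ` ball 0 1)"
    using open_mapping_thm3[OF g(1) _ g(2)] by auto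
  obtain \<gamma> where \<gamma>: "\<gamma> holomorphic_on g ` ball 0 1"
    "\<And>z. z \<in> ball 0 1 \<Longrightarrow> deriv g z * deriv \<gamma> (g z) = 1"
    "\<And>z. z \<in> ball 0 1 \<Longrightarrow> \<gamma> (g z) = z"
    using holomorphic_has_inverse[OF g(1) open_ball g(2)] by metis
  have "(\<gamma> has_field_derivative inverse (deriv g z)) (at (g z))" if "z \<in> ball 0 1" for z
  proof -
    have "inverse (deriv g z) = deriv \<gamma> (g z)"
      using \<gamma>(2)[OF that] inverse_unique by blast
    then show ?thesis
      using holomorphic_derivI[OF \<gamma>(1) op] that by auto
  qed
  moreover have "deriv g z \<noteq> 0" if "z \<in> ball 0 1" for z
    using \<gamma>(2)[OF that] by auto
  ultimately show ?thesis
    using that[OF \<gamma>(1) op g(3) \<gamma>(3)] by blast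
qed

text \<open>Mean value theorem along the preimage of the segment from \<open>g z\<^sub>1\<close> to \<open>g z\<^sub>2\<close>.\<close>

lemma Re_quotient_pos:
  assumes g: "convex_function g" and k: "k holomorphic_on ball 0 1"
    and pos: "\<And>z. z \<in> ball 0 1 \<Longrightarrow> Re (deriv k z / deriv g z) > 0"
    and z: "z1 \<in> ball 0 1" "z2 \<in> ball 0 1" "z1 \<noteq> z2"
  shows "Re ((k z2 - k z1) / (g z2 - g z1)) > 0"
proof -
  obtain \<gamma> where \<gamma>: "convex (g ` ball 0 1)"
    "\<And>z. z \<in> ball 0 1 \<Longrightarrow> \<gamma> (g z) = z"
    "\<And>z. z \<in> ball 0 1 \<Longrightarrow> (\<gamma> has_field_derivative inverse (deriv g z)) (at (g z))"
    using convex_function_inverse[OF g] by metis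
  define d where "d = g z2 - g z1"
  have d: "d \<noteq> 0"
    using g z by (auto simp: d_def convex_function_def inj_on_def)
  \<comment> \<open>The complex mean value theorem only yields an identity of real parts. Dividing
    by \<open>d\<close> beforehand makes the increment times the derivative collapse to
    \<open>deriv k v / deriv g v\<close>.\<close>
  have "((\<lambda>w. k (\<gamma> w) / d) has_field_derivative
      deriv k (\<gamma> u) * inverse (deriv g (\<gamma> u)) / d) (at u)"
    if "u \<in> closed_segment (g z1) (g z2)" for u
  proof -
    have "u \<in> g ` ball 0 1"
      using that \<gamma>(1) z by (meson convex_contains_segment image_eqI subsetD)
    then obtain v where v: "v \<in> ball 0 1" "u = g v" by auto
    have k': "(k has_field_derivative deriv k v) (at (\<gamma> u))"
      using holomorphic_derivI[OF k open_ball v(1)] \<gamma>(2) v by simp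
    show ?thesis
      using DERIV_chain2[where f = k and g = \<gamma>, OF k'] \<gamma>(2,3)[OF v(1)] v
      by (auto intro!: DERIV_cdivide)
  qed
  from complex_mvt_line[of "g z1" "g z2" "\<lambda>w. k (\<gamma> w) / d" "\<lambda>u. deriv k (\<gamma> u) * inverse (deriv g (\<gamma> u)) / d", OF this]
  obtain u where u: "u \<in> closed_segment (g z1) (g z2)"
    "Re (k (\<gamma> (g z2)) / d) - Re (k (\<gamma> (g z1)) / d)
       = Re (deriv k (\<gamma> u) * inverse (deriv g (\<gamma> u)) / d * (g z2 - g z1))"
    by blast
  have "u \<in> g ` ball 0 1"
    using u \<gamma>(1) z by (meson convex_contains_segment image_eqI subsetD)
  then obtain v where v: "v \<in> ball 0 1" "u = g v" by auto
  have "Re ((k z2 - k z1) / d) = Re (k (\<gamma> (g z2)) / d) - Re (k (\<gamma> (g z1)) / d)"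
    unfolding minus_complex.sel(1)[symmetric] diff_divide_distrib using z \<gamma>(2) by simp
  also have "\<dots> = Re (deriv k v / deriv g v)"
  proof -
    have "deriv k v * inverse (deriv g v) / d * d = deriv k v / deriv g v"
      using d by (simp add: divide_inverse)
    then show ?thesis unfolding u(2) d_def[symmetric] v(2) \<gamma>(2)[OF v(1)] by (rule arg_cong)
  qed
  finally have "Re ((k z2 - k z1) / d) = Re (deriv k v / deriv g v)" .
  then show ?thesis
    using pos[OF v(1)] by (simp add: d_def)
qed

text \<open>By the open mapping theorem: a nonconstant \<open>\<phi>\<close> taking a value on the
  imaginary axis would also take values to the left of it.\<close>

lemma Re_pos_of_nonneg:
  assumes "\<phi> holomorphic_on ball 0 1" "\<And>z. z \<in> ball 0 1 \<Longrightarrow> Re (\<phi> z) \<ge> 0" "Re (\<phi> 0) > 0"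
    and z: "z \<in> ball 0 1"
  shows "Re (\<phi> z) > 0"
proof (rule ccontr)
  assume "\<not> ?thesis"
  then have z0: "Re (\<phi> z) = 0" using assms(2)[OF z] by auto
  have "\<not> \<phi> constant_on ball 0 1"
    using z0 assms(3) z by (fastforce simp: constant_on_def)
  then have "open (\<phi> ` ball 0 1)"
    using open_mapping_thm[OF assms(1), of "ball 0 1"] by auto
  then obtain e where e: "e > 0" "ball (\<phi> z) e \<subseteq> \<phi> ` ball 0 1"
    using z by (meson image_eqI openE)
  have "\<phi> z - of_real (e/2) \<in> ball (\<phi> z) e" using e(1) by (simp add: dist_norm)
  then obtain v where "v \<in> ball 0 1" "\<phi> v = \<phi> z - of_real (e/2)" using e(2) by (metis imageE subsetD)
  then show False using assms(2)[of v] z0 e(1) by simp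
qed

text \<open>The Schwarz lemma applied to \<open>z \<mapsto> g\<^sup>-\<^sup>1 ((1 - t) g z + t g (x z))\<close>, differentiated at \<open>t = 0\<close>.\<close>

lemma convex_function_support:
  assumes g: "convex_function g" and x: "norm x \<le> 1" and z: "z \<in> ball 0 1" "z \<noteq> 0"
  shows "Re ((g z - g (x * z)) / (z * deriv g z)) \<ge> 0"
proof (rule ccontr)
  assume neg: "\<not> ?thesis"
  obtain \<gamma> where \<gamma>: "\<gamma> holomorphic_on g ` ball 0 1" "convex (g ` ball 0 1)"
    "\<And>z. z \<in> ball 0 1 \<Longrightarrow> \<gamma> (g z) = z"
    "\<And>z. z \<in> ball 0 1 \<Longrightarrow> (\<gamma> has_field_derivative inverse (deriv g z)) (at (g z))"
    "\<And>z. z \<in> ball 0 1 \<Longrightarrow> deriv g z \<noteq> 0"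
    using convex_function_inverse[OF g] by metis
  have gh: "g holomorphic_on ball 0 1" using g by (auto simp: convex_function_def)
  have xb: "x * v \<in> ball 0 1" if "v \<in> ball 0 1" for v
    using that x mult_left_le_one_le[of "norm v" "norm x"] by (simp add: norm_mult)
  define m where "m t v = g v + of_real t * (g (x * v) - g v)" for t v
  have m: "m t v \<in> g ` ball 0 1" if "t \<in> {0..1}" "v \<in> ball 0 1" for t v
  proof -
    have "(1 - t) *\<^sub>R g v + t *\<^sub>R g (x * v) \<in> g ` ball 0 1"
      using that xb by (intro convexD_alt[OF \<gamma>(2)]) auto
    then show ?thesis by (simp add: m_def scaleR_conv_of_real algebra_simps)
  qed
  have schwarz: "norm (\<gamma> (m t z)) \<le> norm z" if t: "t \<in> {0..1}" for t
  proof (rule Schwarz_Lemma(1))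
    show "(\<lambda>v. \<gamma> (m t v)) holomorphic_on ball 0 1"
    proof (rule holomorphic_on_compose_gen[OF _ \<gamma>(1), unfolded o_def])
      have "(\<lambda>v. g (x * v)) holomorphic_on ball 0 1"
        by (rule holomorphic_on_compose_gen[OF _ gh, unfolded o_def])
           (use xb in \<open>auto intro!: holomorphic_intros simp: xb\<close>)
      then show "m t holomorphic_on ball 0 1"
        unfolding m_def by (intro holomorphic_intros gh)
    qed (use m t in auto)
    show "\<gamma> (m t 0) = 0" using \<gamma>(3)[of 0] by (simp add: m_def)
    fix v :: complex assume "norm v < 1"
    then obtain u where "u \<in> ball 0 1" "m t v = g u" using m[OF t, of v] by auto
    then show "norm (\<gamma> (m t v)) < 1" using \<gamma>(3) by auto
  qed (use z in auto)
  define c where "c = inverse (deriv g z) * (g (x * z) - g z)"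
  have \<gamma>0: "\<gamma> (m 0 z) = z" using \<gamma>(3) z by (simp add: m_def)
  have "((\<lambda>t. \<gamma> (m t z)) has_vector_derivative (g (x * z) - g z) * inverse (deriv g z)) (at 0)"
  proof (rule field_vector_diff_chain_at[where f = "\<lambda>t. m t z" and g = \<gamma>, unfolded o_def])
    show "((\<lambda>t. m t z) has_vector_derivative g (x * z) - g z) (at 0)"
      unfolding m_def by (auto intro!: derivative_eq_intros)
    show "(\<gamma> has_field_derivative inverse (deriv g z)) (at (m 0 z))"
      using \<gamma>(4) z by (simp add: m_def)
  qed
  then have D: "((\<lambda>t. \<gamma> (m t z)) has_vector_derivative c) (at 0)"
    by (simp add: c_def mult.commute)
  \<comment> \<open>If the claim fails, then \<open>Re (c / z) > 0\<close>, so the squared norm has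
    positive derivative at 0 and the path leaves the disc of radius \<open>norm z\<close>, against
    \<open>schwarz\<close>.\<close>
  have "((\<lambda>t. (\<gamma> (m t z)) \<bullet> (\<gamma> (m t z))) has_real_derivative 2 * (z \<bullet> c)) (at 0)"
    unfolding has_real_derivative_iff_has_vector_derivative
    using bounded_bilinear.has_vector_derivative[OF bounded_bilinear_inner D D] \<gamma>0
    by (simp add: inner_commute)
  moreover have "z \<bullet> c > 0"
  proof -
    have "(g z - g (x * z)) / (z * deriv g z) = - c / z"
      using z \<gamma>(5) by (simp add: c_def field_simps)
    then have "Re (c / z) > 0" using neg by simp
    then have "Re (c / z) * (norm z)^2 > 0" using z by simp
    also have "Re (c / z) * (norm z)^2 = z \<bullet> c"
      using z by (simp add: complex_div_cnj[of c z] Re_divide_of_real inner_complex_def)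
    finally show ?thesis .
  qed
  ultimately obtain d where d: "d > 0"
    "\<And>h. h > 0 \<Longrightarrow> h < d \<Longrightarrow> \<gamma> (m 0 z) \<bullet> \<gamma> (m 0 z) < \<gamma> (m (0 + h) z) \<bullet> \<gamma> (m (0 + h) z)"
    using DERIV_pos_inc_right[of "\<lambda>t. \<gamma> (m t z) \<bullet> \<gamma> (m t z)" "2 * (z \<bullet> c)" 0] by auto
  \<comment> \<open>The cap at 1 keeps \<open>h\<close> in the range of parameters covered by
    \<open>schwarz\<close>.\<close>
  define h where "h = min (d/2) 1"
  have "h > 0" "h < d" "h \<in> {0..1}" using d(1) by (auto simp: h_def)
  with d(2)[of h] \<gamma>0 have "(norm z)\<^sup>2 < (norm (\<gamma> (m h z)))\<^sup>2"
    by (simp add: power2_norm_eq_inner)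
  moreover have "(norm (\<gamma> (m h z)))\<^sup>2 \<le> (norm z)\<^sup>2"
    using schwarz[OF \<open>h \<in> {0..1}\<close>] by (intro power_mono) auto
  ultimately show False by simp
qed

section \<open>Coefficient bounds\<close>

text \<open>Cauchy's inequality on circles of radius \<open>r < 1\<close>, followed by
  \<open>r \<rightarrow> 1\<close>, since nothing is known about \<open>\<phi>\<close> on the unit
  circle itself.\<close>

lemma fps_nth_le_1_of_bounded:
  assumes "\<phi> holomorphic_on ball 0 1" "\<And>z. z \<in> ball 0 1 \<Longrightarrow> norm (\<phi> z) \<le> 1" "\<phi> has_fps_expansion F"
  shows "norm (fps_nth F n) \<le> 1"
proof -
  have bound: "norm (fps_nth F n) * r ^ n \<le> 1" if r: "r \<in> {0<..<1}" for r :: real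
  proof -
    have "norm ((deriv ^^ n) \<phi> 0) \<le> fact n * 1 / r ^ n"
    proof (rule Cauchy_inequality)
      show "\<phi> holomorphic_on ball 0 r"
        using r by (intro holomorphic_on_subset[OF assms(1)]) auto
      show "continuous_on (cball 0 r) \<phi>"
        using r by (intro holomorphic_on_imp_continuous_on holomorphic_on_subset[OF assms(1)]) auto
    qed (use r assms(2) in auto)
    then show ?thesis
      using r by (simp add: fps_nth_fps_expansion[OF assms(3)] norm_divide field_simps)
  qed
  have "((\<lambda>r::real. norm (fps_nth F n) * r ^ n) \<longlongrightarrow> norm (fps_nth F n) * 1 ^ n) (at_left 1)"
    by (intro tendsto_intros)
  moreover have "eventually (\<lambda>r::real. norm (fps_nth F n) * r ^ n \<le> 1) (at_left 1)"
    using eventually_at_left_real[of 0 1] by (auto elim!: eventually_mono intro: bound)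
  ultimately show ?thesis
    using tendsto_upperbound by fastforce
qed

text \<open>
  Averaging \<open>h\<close> over the rotations by \<open>n\<close>-th roots of unity keeps its values in the convex set
  \<open>\<Omega>\<close>, while only the coefficients of index divisible by \<open>n\<close> survive.
\<close>

lemma convex_range_coeff_bound:
  assumes \<Omega>: "open \<Omega>" "convex \<Omega>" and h: "h holomorphic_on ball 0 1" "\<And>z. z \<in> ball 0 1 \<Longrightarrow> h z \<in> \<Omega>"
    and \<psi>: "\<psi> holomorphic_on \<Omega>" "\<And>w. w \<in> \<Omega> \<Longrightarrow> norm (\<psi> w) \<le> 1" "\<psi> (h 0) = 0"
    and H: "h has_fps_expansion H" and n: "n > 0"
  shows "norm (deriv \<psi> (h 0) * fps_nth H n) \<le> 1"
proof -
  define \<omega> where "\<omega> = cis (2 * pi / n)"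
  have \<omega>n: "\<omega> ^ n = 1"
  proof -
    have "real n * (2 * pi / real n) = 2 * pi" using n by simp
    then show ?thesis by (simp only: \<omega>_def Complex.DeMoivre cis_2pi)
  qed
  have norm\<omega>: "norm (\<omega> ^ j) = 1" for j by (simp add: \<omega>_def norm_power)
  have \<omega>m: "\<omega> ^ m \<noteq> 1" if "0 < m" "m < n" for m
  proof -
    have "\<omega> ^ m = exp (2 * of_real pi * \<i> * of_nat m / of_nat n)"
      by (simp only: \<omega>_def Complex.DeMoivre) (simp add: cis_conv_exp mult_ac)
    then show ?thesis
      using complex_root_unity_eq[of n m 0] that by (auto simp: nat_neq_iff cong_def)
  qed
  have rot: "\<omega> ^ j * z \<in> ball 0 1" if "z \<in> ball 0 1" for z j
    using that norm\<omega> by (simp add: norm_mult)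
  define G where "G z = (\<Sum>j<n. of_real (1 / n) * h (\<omega> ^ j * z))" for z
  have G\<Omega>: "G z \<in> \<Omega>" if "z \<in> ball 0 1" for z
  proof -
    have "(\<Sum>j<n. (1 / real n) *\<^sub>R h (\<omega> ^ j * z)) \<in> \<Omega>"
      using n h(2) rot[OF that] by (intro convex_sum \<Omega>) auto
    then show ?thesis by (simp add: G_def scaleR_conv_of_real)
  qed
  have Gh: "G holomorphic_on ball 0 1"
  proof -
    have "(\<lambda>z. h (\<omega> ^ j * z)) holomorphic_on ball 0 1" for j
      by (rule holomorphic_on_compose_gen[OF _ h(1), unfolded o_def])
         (use rot in \<open>auto intro!: holomorphic_intros\<close>)
    then show ?thesis unfolding G_def by (intro holomorphic_intros)
  qed
  define Q where "Q = (\<Sum>j<n. fps_const (of_real (1 / n)) * (H oo (fps_const (\<omega> ^ j) * fps_X))) - fps_const (h 0)"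
  have Q: "(\<lambda>z. G z - h 0) has_fps_expansion Q"
    unfolding G_def Q_def
    by (intro fps_expansion_intros has_fps_expansion_compose[OF H, unfolded o_def]) auto
  have sum\<omega>: "(\<Sum>j<n. (\<omega> ^ j) ^ m) = (if m = 0 \<or> m = n then of_nat n else 0)" if "m \<le> n" for m
  proof (cases "m = 0 \<or> m = n")
    case True
    then have "(\<omega> ^ j) ^ m = 1" for j
      using \<omega>n by (metis mult.commute power_0 power_mult power_one)
    then show ?thesis using True by simp
  next
    case False
    then have "\<omega> ^ m \<noteq> 1" using \<omega>m[of m] that by auto
    moreover have "(\<omega> ^ m) ^ n = 1" using \<omega>n by (metis mult.commute power_mult power_one)
    ultimately have "(\<Sum>j<n. (\<omega> ^ m) ^ j) = 0" by (simp add: geometric_sum)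
    moreover have "(\<omega> ^ j) ^ m = (\<omega> ^ m) ^ j" for j by (metis mult.commute power_mult)
    ultimately show ?thesis using False by simp
  qed
  have H0: "fps_nth H 0 = h 0" using has_fps_expansion_imp_0_eq_fps_nth_0[OF H] by simp
  have rotH: "fps_nth (H oo (fps_const c * fps_X)) m = c ^ m * fps_nth H m" for c m
    by (simp only: fps_compose_linear fps_nth_Abs_fps)
  \<comment> \<open>Up to order \<open>n\<close>, the average differs from \<open>h 0\<close> only
    by the term of index \<open>n\<close>. The vanishing constant term also makes the composition
    with \<open>P\<close> legitimate.\<close>
  have Q_nth: "fps_nth Q m = (if m = n then fps_nth H n else 0)" if "m \<le> n" for m
  proof -
    have "fps_nth Q m = of_real (1 / n) * fps_nth H m * (\<Sum>j<n. (\<omega> ^ j) ^ m) - (if m = 0 then h 0 else 0)"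
      unfolding Q_def fps_sub_nth fps_sum_nth fps_mult_left_const_nth rotH sum_distrib_left by (simp add: mult_ac)
    then show ?thesis using n H0 unfolding sum\<omega>[OF that] by (cases "m = 0"; cases "m = n") auto
  qed
  define P where "P = fps_expansion \<psi> (h 0)"
  have an: "\<psi> analytic_on {h 0}"
    using \<psi>(1) \<Omega>(1) h(2)[of 0] by (auto simp: analytic_at)
  have P: "(\<lambda>u. \<psi> (h 0 + u)) has_fps_expansion P"
    unfolding P_def by (rule analytic_at_imp_has_fps_expansion[OF an])
  have PQ: "(\<lambda>z. \<psi> (G z)) has_fps_expansion (P oo Q)"
    using has_fps_expansion_compose[OF P Q] Q_nth[of 0] n by (simp add: o_def)
  have "norm (fps_nth (P oo Q) n) \<le> 1"
  proof (rule fps_nth_le_1_of_bounded[OF _ _ PQ])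
    show "(\<lambda>z. \<psi> (G z)) holomorphic_on ball 0 1"
      by (rule holomorphic_on_compose_gen[OF Gh \<psi>(1), unfolded o_def]) (use G\<Omega> in auto)
  qed (use \<psi>(2) G\<Omega> in auto)
  \<comment> \<open>\<open>Q\<close> starts at order \<open>n\<close>, so its powers with exponent
    at least 2 start beyond order \<open>n\<close>, and only the linear term of \<open>P\<close>
    contributes.\<close>
  moreover have "fps_nth (P oo Q) n = fps_nth P 1 * fps_nth H n"
  proof -
    have "fps_nth P i * fps_nth (Q ^ i) n = (if i = 1 then fps_nth P 1 * fps_nth H n else 0)" for i
    proof -
      consider "i = 0" | "i = 1" | "i \<ge> 2" by linarith
      then show ?thesis
      proof cases
        case 1
        then show ?thesis using n by simp
      next
        case 3
        show ?thesis
        proof (cases "Q = 0")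
          case False
          have "subdegree Q \<ge> n"
          proof (rule subdegree_geI[OF False])
            show "fps_nth Q i = 0" if "i < n" for i using Q_nth[of i] that by simp
          qed
          then have "n < subdegree (Q ^ i)"
            using 3 n mult_le_mono[of 2 i n "subdegree Q"] by simp
          from nth_less_subdegree_zero[OF this] show ?thesis using 3 by simp
        qed (use 3 in \<open>simp add: power_0_left\<close>)
      qed (use Q_nth[of n] in simp)
    qed
    then show ?thesis using n by (simp add: fps_compose_nth)
  qed
  moreover have "fps_nth P 1 = deriv \<psi> (h 0)" by (simp add: P_def fps_expansion_def)
  ultimately show ?thesis by simp
qed

text \<open>The averaging bound with \<open>\<psi>\<close> the inverse of \<open>g\<close>, whose
  derivative at \<open>g 0\<close> is \<open>inverse (deriv g 0)\<close>.\<close>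

lemma convex_function_coeff_bound:
  assumes g: "convex_function g" and G: "g has_fps_expansion G" and n: "n > 0"
  shows "norm (fps_nth G n) \<le> norm (deriv g 0)"
proof -
  obtain \<gamma> where \<gamma>: "\<gamma> holomorphic_on g ` ball 0 1" "open (g ` ball 0 1)" "convex (g ` ball 0 1)"
    "\<And>z. z \<in> ball 0 1 \<Longrightarrow> \<gamma> (g z) = z"
    "\<And>z. z \<in> ball 0 1 \<Longrightarrow> (\<gamma> has_field_derivative inverse (deriv g z)) (at (g z))"
    "\<And>z. z \<in> ball 0 1 \<Longrightarrow> deriv g z \<noteq> 0"
    using convex_function_inverse[OF g] by metis
  have "norm (deriv \<gamma> (g 0) * fps_nth G n) \<le> 1"
    by (rule convex_range_coeff_bound[OF \<gamma>(2,3) _ _ \<gamma>(1) _ _ G n])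
       (use g \<gamma>(4) in \<open>auto simp: convex_function_def intro: less_imp_le\<close>)
  moreover have "deriv \<gamma> (g 0) = inverse (deriv g 0)" using \<gamma>(5)[of 0] by (auto intro: DERIV_imp_deriv)
  ultimately have "norm (fps_nth G n) / norm (deriv g 0) \<le> 1"
    by (simp add: norm_inverse divide_inverse_commute norm_mult)
  then show ?thesis using \<gamma>(6)[of 0] by (simp add: divide_le_eq)
qed

section \<open>Functions with positive real part\<close>

text \<open>In the right half-plane, \<open>w\<close> is nearer to \<open>a\<close> than to the
  mirror image \<open>- cnj a\<close>.\<close>

lemma cayley_bound:
  assumes "Re a > 0" "Re w > 0"
  shows "norm ((w - a) / (w + cnj a)) < 1"
proof -
  have "(Re w - Re a)\<^sup>2 + (Im w - Im a)\<^sup>2 < (Re w + Re a)\<^sup>2 + (Im w - Im a)\<^sup>2"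
    using mult_pos_pos[OF assms] by (simp add: power2_eq_square algebra_simps)
  then have "norm (w - a) < norm (w + cnj a)"
    by (simp add: cmod_def)
  moreover from this have "norm (w + cnj a) > 0" by (rule le_less_trans[OF norm_ge_zero])
  ultimately show ?thesis by (simp add: norm_divide)
qed

text \<open>Caratheodory's bound, from averaging in the half-plane with the Cayley transform centred
  at \<open>p 0\<close> as \<open>\<psi>\<close>. Its derivative there is
  \<open>1 / (2 * Re (p 0))\<close>, and \<open>p 0\<close> may be non-real.\<close>

lemma Re_pos_coeff_bound:
  assumes p: "p holomorphic_on ball 0 1" "\<And>z. z \<in> ball 0 1 \<Longrightarrow> Re (p z) > 0"
    and P: "p has_fps_expansion P" and n: "n > 0"
  shows "norm (fps_nth P n) \<le> 2 * Re (p 0)"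
proof -
  define a where "a = p 0"
  have a: "Re a > 0" using p(2)[of 0] by (simp add: a_def)
  have nz: "w + cnj a \<noteq> 0" if "Re w > 0" for w using that a by (auto simp: complex_eq_iff)
  have aa: "a + cnj a = of_real (2 * Re a)" by (simp add: complex_eq_iff)
  have "norm (deriv (\<lambda>w. (w - a) / (w + cnj a)) (p 0) * fps_nth P n) \<le> 1"
  proof (rule convex_range_coeff_bound[OF _ _ p(1) _ _ _ _ P n, of "{w. Re w > 0}"])
    show "(\<lambda>w. (w - a) / (w + cnj a)) holomorphic_on {w. 0 < Re w}"
      by (intro holomorphic_intros) (use nz in auto)
    show "norm ((w - a) / (w + cnj a)) \<le> 1" if "w \<in> {w. 0 < Re w}" for w
      using cayley_bound[OF a, of w] that by auto
  qed (auto simp: a_def p(2) open_halfspace_Re_gt convex_halfspace_Re_gt)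
  moreover have "deriv (\<lambda>w. (w - a) / (w + cnj a)) (p 0) = 1 / of_real (2 * Re a)"
  proof (rule DERIV_imp_deriv)
    show "((\<lambda>w. (w - a) / (w + cnj a)) has_field_derivative 1 / of_real (2 * Re a)) (at (p 0))"
      using nz[OF a] aa by (auto intro!: derivative_eq_intros simp: a_def[symmetric] aa divide_simps)
  qed
  ultimately show ?thesis using a by (simp add: norm_divide norm_mult a_def field_simps)
qed

text \<open>The Schwarz lemma bounds the Cayley transform \<open>\<omega>\<close> of
  \<open>p z\<close> by \<open>norm z\<close>. Solving for \<open>p z\<close> gives
  \<open>p z * (1 - \<omega>) = a + cnj a * \<omega>\<close>, and the triangle inequality
  finishes.\<close>

lemma Re_pos_lower_bound:
  assumes p: "p holomorphic_on ball 0 1" "\<And>z. z \<in> ball 0 1 \<Longrightarrow> Re (p z) > 0" and z: "z \<in> ball 0 1"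
  shows "norm (p z) * (1 + norm z) \<ge> norm (p 0) * (1 - norm z)"
proof -
  define a where "a = p 0"
  have a: "Re a > 0" using p(2)[of 0] by (simp add: a_def)
  have nz: "w + cnj a \<noteq> 0" if "Re w > 0" for w using that a by (auto simp: complex_eq_iff)
  define \<omega> where "\<omega> = (p z - a) / (p z + cnj a)"
  have "norm \<omega> \<le> norm z"
    unfolding \<omega>_def
  proof (rule Schwarz_Lemma(1)[where f = "\<lambda>v. (p v - a) / (p v + cnj a)"])
    show "(\<lambda>v. (p v - a) / (p v + cnj a)) holomorphic_on ball 0 1"
      by (intro holomorphic_intros p) (use nz p in auto)
  qed (use z a p(2) cayley_bound[OF a] in \<open>auto simp: a_def\<close>)
  have "\<omega> * (p z + cnj a) = p z - a"
    using nz[OF p(2)[OF z]] by (simp add: \<omega>_def)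
  then have "p z * (1 - \<omega>) = a + cnj a * \<omega>"
    by algebra
  then have eq: "norm (p z) * norm (1 - \<omega>) = norm (a + cnj a * \<omega>)" by (metis norm_mult)
  have "norm a * (1 - norm z) \<le> norm a - norm a * norm \<omega>"
    using mult_left_mono[OF \<open>norm \<omega> \<le> norm z\<close>, of "norm a"] by (simp add: algebra_simps)
  also have "\<dots> \<le> norm (a + cnj a * \<omega>)"
    using norm_diff_ineq[of a "cnj a * \<omega>"] by (simp add: norm_mult)
  also have "\<dots> \<le> norm (p z) * (1 + norm z)"
    unfolding eq[symmetric] using norm_triangle_ineq4[of 1 \<omega>] \<open>norm \<omega> \<le> norm z\<close>
    by (intro mult_left_mono) auto
  finally show ?thesis by (simp add: a_def)
qed

section \<open>Distortion and covering\<close>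

lemma convex_function_deriv2_0:
  assumes "convex_function g"
  shows "norm (deriv (deriv g) 0) \<le> 2 * norm (deriv g 0)"
proof -
  have "g has_fps_expansion fps_expansion g 0"
    using assms by (intro has_fps_expansion_fps_expansion[of "ball 0 1"]) (auto simp: convex_function_def)
  from convex_function_coeff_bound[OF assms this, of 2] show ?thesis
    by (simp add: fps_expansion_def norm_divide numeral_2_eq_2)
qed

text \<open>Precomposition with disc automorphisms transports the bound at \<open>0\<close> to the point \<open>a\<close>.\<close>

lemma convex_function_deriv2:
  assumes g: "convex_function g" and a: "a \<in> ball 0 1"
  shows "norm (of_real (1 - (norm a)\<^sup>2) * deriv (deriv g) a - 2 * cnj a * deriv g a) \<le> 2 * norm (deriv g a)"
proof -
  \<comment> \<open>This is the automorphism \<open>z \<mapsto> (z + a) / (1 + cnj a * z)\<close>,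
    which sends 0 to \<open>a\<close>.\<close>
  define M where "M = Moebius_function 0 (- a)"
  define \<delta> where "\<delta> = complex_of_real (1 - (norm a)\<^sup>2)"
  have na: "norm a < 1" using a by simp
  have gh: "g holomorphic_on ball 0 1" and ginj: "inj_on g (ball 0 1)" and gconv: "convex (g ` ball 0 1)"
    using g by (auto simp: convex_function_def)
  have Mb: "M z \<in> ball 0 1" if "z \<in> ball 0 1" for z
    using that na Moebius_function_norm_lt_1[of "- a" z 0] by (simp add: M_def)
  have inv1: "Moebius_function 0 a (M z) = z" if "z \<in> ball 0 1" for z
    using Moebius_function_compose[of a "- a" z] na that by (simp add: M_def)
  have inv2: "M (Moebius_function 0 a z) = z" if "z \<in> ball 0 1" for z
    using Moebius_function_compose[of "- a" a z] na that by (simp add: M_def)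
  have Mh: "M holomorphic_on ball 0 1"
    unfolding M_def by (rule Moebius_function_holomorphic) (use na in auto)
  have imM: "M ` ball 0 1 = ball 0 1"
  proof
    show "ball 0 1 \<subseteq> M ` ball 0 1"
    proof
      fix z :: complex assume "z \<in> ball 0 1"
      then show "z \<in> M ` ball 0 1"
        using inv2[of z] Moebius_function_norm_lt_1[of a z 0] na
        by (intro image_eqI[of _ _ "Moebius_function 0 a z"]) auto
    qed
  qed (use Mb in auto)
  have M0: "M 0 = a" by (simp add: M_def Moebius_function_simple)
  have nz: "1 + cnj a * z \<noteq> 0" if "z \<in> ball 0 1" for z
  proof
    assume "1 + cnj a * z = 0"
    then have "cnj a * z = - 1" by (simp add: add_eq_0_iff)
    then have "norm a * norm z = 1" by (metis complex_mod_cnj norm_minus_cancel norm_mult norm_one)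
    moreover have "norm a * norm z < 1 * 1"
      using na that by (intro mult_strict_mono') auto
    ultimately show False by simp
  qed
  have \<delta>: "\<delta> = 1 - a * cnj a" by (simp add: \<delta>_def complex_norm_square[symmetric])
  have M': "(M has_field_derivative \<delta> / (1 + cnj a * z)\<^sup>2) (at z)" if "z \<in> ball 0 1" for z
    unfolding M_def Moebius_function_simple using nz[OF that]
    by (auto intro!: derivative_eq_intros simp: \<delta> power2_eq_square algebra_simps)
  define G where "G = g \<circ> M"
  have G: "convex_function G"
    unfolding convex_function_def
  proof (intro conjI)
    show "G holomorphic_on ball 0 1"
      unfolding G_def by (rule holomorphic_on_compose_gen[OF Mh gh]) (use Mb in auto)
    show "inj_on G (ball 0 1)"
    proof (rule inj_onI)
      fix x y assume xy: "x \<in> ball 0 1" "y \<in> ball 0 1" "G x = G y"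
      then have "M x = M y" using ginj Mb by (auto simp: G_def inj_on_def)
      then show "x = y" using inv1 xy by metis
    qed
    show "convex (G ` ball 0 1)"
      unfolding G_def image_comp[symmetric] imM by (rule gconv)
  qed
  \<comment> \<open>A closed form of \<open>deriv G\<close> on the disc, to be differentiated once
    more at 0. Both derivatives of \<open>G\<close> at 0 then carry a factor
    \<open>\<delta>\<close>, which cancels at the end.\<close>
  define H where "H z = deriv g (M z) * (\<delta> / (1 + cnj a * z)\<^sup>2)" for z
  have G': "deriv G z = H z" if "z \<in> ball 0 1" for z
    unfolding G_def H_def
    using DERIV_chain[OF holomorphic_derivI[OF gh open_ball Mb[OF that]] M'[OF that]]
    by (intro DERIV_imp_deriv) simp
  have "(H has_field_derivative
      deriv (deriv g) a * \<delta> * \<delta> + deriv g a * (- 2 * cnj a * \<delta>)) (at 0)"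
  proof -
    have "deriv g holomorphic_on ball 0 1" using gh by (intro holomorphic_deriv) auto
    then have "(deriv g has_field_derivative deriv (deriv g) a) (at (M 0))"
      using holomorphic_derivI[OF _ open_ball a] M0 by simp
    from DERIV_chain2[OF this M'[of 0]]
    have 1: "((\<lambda>z. deriv g (M z)) has_field_derivative deriv (deriv g) a * \<delta>) (at 0)" by simp
    have 2: "((\<lambda>z. \<delta> / (1 + cnj a * z)\<^sup>2) has_field_derivative - 2 * cnj a * \<delta>) (at 0)"
      by (auto intro!: derivative_eq_intros)
    show ?thesis
      unfolding H_def using DERIV_mult[OF 1 2] by (simp add: M0 algebra_simps)
  qed
  moreover have "deriv (deriv G) 0 = deriv H 0"
    using G' by (intro deriv_cong_ev eventually_nhds_in_open[THEN eventually_mono, of "ball 0 1"]) auto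
  ultimately have "deriv (deriv G) 0 = \<delta> * (\<delta> * deriv (deriv g) a - 2 * cnj a * deriv g a)"
    by (simp add: DERIV_imp_deriv algebra_simps)
  moreover have "deriv G 0 = \<delta> * deriv g a" using G'[of 0] by (simp add: H_def M0)
  ultimately have "norm \<delta> * norm (\<delta> * deriv (deriv g) a - 2 * cnj a * deriv g a) \<le> norm \<delta> * (2 * norm (deriv g a))"
    using convex_function_deriv2_0[OF G] by (simp add: norm_mult)
  moreover have "norm \<delta> > 0"
  proof -
    have "(norm a)\<^sup>2 < 1" using na by (simp add: abs_square_less_1)
    then show ?thesis unfolding \<delta>_def norm_of_real by simp
  qed
  ultimately show ?thesis unfolding \<delta>_def by (simp only: mult_le_cancel_left_pos)
qed

text \<open>Along the radius to \<open>z\<close>, the second-derivative estimate makes the square of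
  \<open>norm (deriv g (t * z)) * (1 + t * r)\<^sup>2\<close> nondecreasing in \<open>t\<close>.
  Squaring turns the norm into an inner product, which is easy to differentiate.\<close>

lemma convex_function_deriv_lower:
  assumes g: "convex_function g" and z: "z \<in> ball 0 1"
  shows "norm (deriv g z) * (1 + norm z)\<^sup>2 \<ge> norm (deriv g 0)"
proof -
  define r where "r = norm z"
  have r: "0 \<le> r" "r < 1" using z by (auto simp: r_def)
  have "deriv g holomorphic_on ball 0 1"
    using g by (intro holomorphic_deriv) (auto simp: convex_function_def)
  note g' = holomorphic_derivI[OF this open_ball]
  define V where "V t = deriv g (of_real t * z)" for t
  define m where "m t = (V t \<bullet> V t) * (1 + t * r)^4" for t
  have "m 0 \<le> m 1"
  proof (rule DERIV_nonneg_imp_nondecreasing[where f = m])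
    fix t :: real assume t: "0 \<le> t" "t \<le> 1"
    define a where "a = of_real t * z"
    have na: "norm a = t * r" using t by (simp add: a_def r_def norm_mult)
    have "t * r \<le> 1 * r" using t r by (intro mult_right_mono) auto
    then have na1: "norm a < 1" and a: "a \<in> ball 0 1" using na r by auto
    define W where "W = z * deriv (deriv g) a"
    have "(V has_vector_derivative W) (at t)"
      unfolding V_def W_def a_def
    proof (rule field_vector_diff_chain_at[where f = "\<lambda>t. of_real t * z" and g = "deriv g", unfolded o_def])
      show "((\<lambda>t. of_real t * z) has_vector_derivative z) (at t)"
        by (auto intro!: derivative_eq_intros)
    qed (use g' a in \<open>auto simp: a_def\<close>)
    from bounded_bilinear.has_vector_derivative[OF bounded_bilinear_inner this this]
    have "((\<lambda>t. V t \<bullet> V t) has_real_derivative 2 * (V t \<bullet> W)) (at t)"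
      unfolding has_real_derivative_iff_has_vector_derivative by (simp add: inner_commute)
    then have D: "(m has_real_derivative 2 * (V t \<bullet> W) * (1 + t * r)^4 + (4 * r * (1 + t * r)^3) * (V t \<bullet> V t)) (at t)"
      unfolding m_def by (auto intro!: derivative_eq_intros simp: algebra_simps)
    have Va: "V t = deriv g a" by (simp add: V_def a_def)
    define X where "X = of_real (1 - (norm a)\<^sup>2) * deriv (deriv g) a - 2 * cnj a * deriv g a"
    have X: "norm X \<le> 2 * norm (V t)" using convex_function_deriv2[OF g a] by (simp add: X_def Va)
    have "z * cnj a = of_real (t * r\<^sup>2)"
      by (simp add: a_def r_def complex_norm_square mult_ac del: of_real_power)
    then have zX: "z * X = (1 - (norm a)\<^sup>2) *\<^sub>R W - (2 * t * r\<^sup>2) *\<^sub>R V t"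
      by (simp add: X_def W_def Va scaleR_conv_of_real algebra_simps)
    have "- (norm (V t) * norm (z * X)) \<le> V t \<bullet> (z * X)"
      using Cauchy_Schwarz_ineq2[of "V t" "z * X"] by linarith
    moreover have "norm (V t) * norm (z * X) \<le> norm (V t) * (r * (2 * norm (V t)))"
      using X r by (intro mult_left_mono) (auto simp: norm_mult r_def intro!: mult_left_mono)
    ultimately have "- 2 * r * (V t \<bullet> V t) \<le> V t \<bullet> (z * X)"
      by (simp add: power2_norm_eq_inner[symmetric] power2_eq_square mult_ac)
    also have "\<dots> = (1 - (t * r)\<^sup>2) * (V t \<bullet> W) - (2 * t * r\<^sup>2) * (V t \<bullet> V t)"
      by (simp add: zX inner_diff_right na)
    \<comment> \<open>The coefficients \<open>1 - (t * r)\<^sup>2\<close> and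
      \<open>2 * r - 2 * t * r\<^sup>2\<close> share the positive factor \<open>1 - t * r\<close>;
      what remains is, up to a positive factor, the derivative of \<open>m\<close>.\<close>
    finally have "0 \<le> (1 - t * r) * ((1 + t * r) * (V t \<bullet> W) + 2 * r * (V t \<bullet> V t))"
      by (simp add: algebra_simps power2_eq_square)
    then have "0 \<le> (1 + t * r) * (V t \<bullet> W) + 2 * r * (V t \<bullet> V t)"
      using na1 na by (simp add: zero_le_mult_iff)
    then have "0 \<le> 2 * (1 + t * r)^3 * ((1 + t * r) * (V t \<bullet> W) + 2 * r * (V t \<bullet> V t))"
      using t r by (intro mult_nonneg_nonneg) auto
    also have "\<dots> = 2 * (V t \<bullet> W) * (1 + t * r)^4 + (4 * r * (1 + t * r)^3) * (V t \<bullet> V t)"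
      by (simp add: algebra_simps power3_eq_cube power4_eq_xxxx)
    finally show "\<exists>y. (m has_real_derivative y) (at t) \<and> 0 \<le> y"
      using D by blast
  qed simp
  then have "(norm (deriv g 0))\<^sup>2 \<le> (norm (deriv g z) * (1 + r)\<^sup>2)\<^sup>2"
    by (simp add: m_def V_def power2_norm_eq_inner[symmetric] power_mult_distrib flip: power_mult)
  then show ?thesis
    unfolding r_def by (rule power2_le_imp_le) simp
qed

section \<open>Covering discs from a lower bound on the derivative\<close>

text \<open>The direction \<open>v\<close> is the Newton step for \<open>F z = w\<close>: to first
  order \<open>F\<close> moves straight towards \<open>w\<close>, so the distance shrinks at a rate
  equal to itself.\<close>

lemma has_derivative_norm_diff_descent:
  assumes F: "F holomorphic_on ball 0 1" and z: "z \<in> ball 0 1" and neq: "F z \<noteq> w"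
    and v: "v * deriv F z = w - F z"
  shows "((\<lambda>s::real. norm (F (z + of_real s * v) - w)) has_real_derivative - norm (F z - w)) (at 0)"
proof -
  define e where "e = F z - w"
  have "((\<lambda>s. F (z + of_real s * v)) has_vector_derivative v * deriv F z) (at 0)"
  proof (rule field_vector_diff_chain_at[where f = "\<lambda>s. z + of_real s * v" and g = F, unfolded o_def])
    show "((\<lambda>s. z + of_real s * v) has_vector_derivative v) (at 0)"
      by (auto intro!: derivative_eq_intros)
    show "(F has_field_derivative deriv F z) (at (z + of_real 0 * v))"
      using holomorphic_derivI[OF F open_ball z] by simp
  qed
  moreover have "v * deriv F z = - e" using v by (simp add: e_def)
  ultimately have "((\<lambda>s. F (z + of_real s * v) - w) has_vector_derivative - e) (at 0)"
    by (auto intro!: derivative_eq_intros)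
  then show ?thesis
    unfolding has_vector_derivative_def has_field_derivative_def
  proof (rule has_derivative_eq_rhs[OF has_derivative_compose])
    show "(norm has_derivative (\<lambda>x. x \<bullet> sgn e)) (at (F (z + of_real 0 * v) - w))"
      using has_derivative_norm[of e] neq by (simp add: e_def)
    have "norm e \<noteq> 0" using neq by (simp add: e_def)
    then have "e \<bullet> sgn e = norm e"
      by (simp add: sgn_div_norm power2_norm_eq_inner[symmetric] power2_eq_square)
    then show "(\<lambda>s. s *\<^sub>R (- e) \<bullet> sgn e) = (*) (- norm (F z - w))"
      unfolding e_def[symmetric] by (simp add: fun_eq_iff)
  qed
qed

text \<open>
  Minimising \<open>|F z - w| + c K(|z|)\<close> for a constant \<open>c < 1\<close>: at a minimum with \<open>F z \<noteq> w\<close>, moving in the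
  direction in which \<open>F\<close> heads for \<open>w\<close> would decrease the first term faster than the second one grows.
\<close>

lemma covering_radius:
  fixes K k :: "real \<Rightarrow> real"
  assumes F: "F holomorphic_on ball 0 1" "F 0 = 0"
    and K: "\<And>r. 0 \<le> r \<Longrightarrow> r < 1 \<Longrightarrow> (K has_real_derivative k r) (at r)" "K 0 = 0"
    and k: "\<And>r. 0 \<le> r \<Longrightarrow> r < 1 \<Longrightarrow> k r > 0"
    and F': "\<And>z. z \<in> ball 0 1 \<Longrightarrow> norm (deriv F z) \<ge> k (norm z)"
    and \<rho>: "0 < \<rho>" "\<rho> < 1" and w: "norm w < K \<rho>"
  obtains z where "norm z < \<rho>" "F z = w"
proof -
  have Kmono: "K x < K y" if xy: "0 \<le> x" "x < y" "y < 1" for x y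
  proof (rule DERIV_pos_imp_increasing[OF xy(2)])
    show "\<exists>l. (K has_real_derivative l) (at s) \<and> l > 0" if "x \<le> s" "s \<le> y" for s
      using K(1)[of s] k[of s] xy that by auto
  qed
  have Kpos: "K \<rho> > 0" using Kmono[of 0 \<rho>] \<rho> K(2) by simp
  \<comment> \<open>The midpoint leaves room on both sides: \<open>c < 1\<close> gives strict
    descent, and \<open>norm w < c * K \<rho>\<close> forces the minimum into the open disc of
    radius \<open>\<rho>\<close>, by comparison with the value at 0.\<close>
  define c where "c = (norm w / K \<rho> + 1) / 2"
  have "norm w / K \<rho> < 1" "norm w / K \<rho> \<ge> 0" using w Kpos by auto
  then have c: "0 < c" "c < 1" "norm w / K \<rho> < c" unfolding c_def by argo+
  then have wc: "norm w < c * K \<rho>" using Kpos by (simp add: divide_less_eq)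
  define \<Phi> where "\<Phi> z = norm (F z - w) + c * K (norm z)" for z
  have "continuous_on (cball 0 \<rho>) \<Phi>"
  proof -
    have "continuous_on {0..\<rho>} K"
      using K(1) \<rho> by (intro continuous_at_imp_continuous_on ballI DERIV_isCont) fastforce
    then have "continuous_on (cball 0 \<rho>) (\<lambda>z::complex. K (norm z))"
      by (rule continuous_on_compose2) (auto intro!: continuous_intros)
    moreover have "continuous_on (cball 0 \<rho>) F"
      using \<rho> by (intro holomorphic_on_imp_continuous_on holomorphic_on_subset[OF F(1)]) auto
    ultimately show ?thesis unfolding \<Phi>_def by (intro continuous_intros)
  qed
  then obtain z where z: "z \<in> cball 0 \<rho>" "\<And>v. v \<in> cball 0 \<rho> \<Longrightarrow> \<Phi> z \<le> \<Phi> v"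
    using continuous_attains_inf[OF compact_cball, of 0 \<rho> \<Phi>] \<rho> by auto
  have "\<Phi> z \<le> norm w" using z(2)[of 0] \<rho> F(2) K(2) by (simp add: \<Phi>_def)
  then have "c * K (norm z) \<le> norm w" unfolding \<Phi>_def using norm_ge_zero[of "F z - w"] by linarith
  then have "c * K (norm z) < c * K \<rho>" using wc by linarith
  then have "K (norm z) < K \<rho>" using c(1) by simp
  then have z\<rho>: "norm z < \<rho>" using z(1) by (cases "norm z = \<rho>") auto
  then have zb: "z \<in> ball 0 1" using \<rho> by simp
  have F'z: "norm (deriv F z) \<ge> k (norm z)" "k (norm z) > 0" using F'[OF zb] k zb by auto
  have "F z = w"
  proof (rule ccontr)
    assume neq: "F z \<noteq> w"
    define e where "e = F z - w"
    define v where "v = - e / deriv F z"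
    \<comment> \<open>An upper bound for \<open>\<Phi>\<close> along the ray, equal to it at
      \<open>s = 0\<close>. The linear argument of \<open>K\<close> avoids differentiating
      \<open>norm\<close>, which fails at the origin.\<close>
    define \<psi> where "\<psi> s = norm (F (z + of_real s * v) - w) + c * K (norm z + s * norm v)" for s
    have D1: "((\<lambda>s. norm (F (z + of_real s * v) - w)) has_real_derivative - norm e) (at 0)"
      unfolding e_def
      by (rule has_derivative_norm_diff_descent[OF F(1) zb neq]) (use F'z in \<open>auto simp: v_def e_def\<close>)
    have "((\<lambda>s. K (norm z + s * norm v)) has_real_derivative k (norm z) * norm v) (at 0)"
    proof (rule DERIV_chain2[where f = K])
      show "(K has_real_derivative k (norm z)) (at (norm z + 0 * norm v))" using K(1) zb by simp
      show "((\<lambda>s. norm z + s * norm v) has_real_derivative norm v) (at 0)"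
        by (auto intro!: derivative_eq_intros)
    qed
    with D1 have D: "(\<psi> has_real_derivative - norm e + c * (k (norm z) * norm v)) (at 0)"
      unfolding \<psi>_def by (intro derivative_intros DERIV_cmult)
    have "k (norm z) * norm v \<le> norm (deriv F z) * norm v"
      using F'z by (intro mult_right_mono) auto
    also have "\<dots> = norm e" using F'z by (auto simp: v_def norm_divide)
    finally have "c * (k (norm z) * norm v) \<le> c * norm e" using c by simp
    also have "\<dots> < 1 * norm e" using c neq by (intro mult_strict_right_mono) (auto simp: e_def)
    finally have "- norm e + c * (k (norm z) * norm v) < 0" by simp
    from DERIV_neg_dec_right[OF D this] obtain d where d: "d > 0" "\<And>s. 0 < s \<Longrightarrow> s < d \<Longrightarrow> \<psi> s < \<psi> 0"
      by auto
    have nv: "norm v > 0" using neq F'z by (auto simp: v_def e_def)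
    define s where "s = min (d / 2) ((\<rho> - norm z) / norm v)"
    have s: "0 < s" "s < d" using d(1) z\<rho> nv by (auto simp: s_def)
    have "s * norm v \<le> \<rho> - norm z"
      using nv by (auto simp: s_def min_def field_simps)
    then have le: "norm z + s * norm v \<le> \<rho>" by simp
    have tri: "norm (z + of_real s * v) \<le> norm z + s * norm v"
      using norm_triangle_ineq[of z "of_real s * v"] s by (simp add: norm_mult)
    have "K (norm (z + of_real s * v)) \<le> K (norm z + s * norm v)"
      using Kmono[of "norm (z + of_real s * v)" "norm z + s * norm v"] tri le \<rho> by fastforce
    then have "\<Phi> (z + of_real s * v) \<le> \<psi> s" using c by (simp add: \<Phi>_def \<psi>_def)
    also have "\<dots> < \<psi> 0" using d(2) s by blast
    also have "\<dots> = \<Phi> z" by (simp add: \<Phi>_def \<psi>_def)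
    also have "\<dots> \<le> \<Phi> (z + of_real s * v)" using tri le by (intro z(2)) simp
    finally show False by simp
  qed
  with z\<rho> that show ?thesis by blast
qed

section \<open>Alexander's transform\<close>

text \<open>
  Alexander's integral transform preserves convexity. The support property of \<open>g\<close> passes to \<open>h\<close> by
  integration along preimages of segments from the origin. Convexity of the range of \<open>h\<close> then
  follows by looking at the point of \<open>h ` cball 0 r\<close> closest to a point of a chord.
\<close>

lemma convex_function_Alexander:
  assumes g: "convex_function g" and g0: "g 0 = 0"
  obtains h where "convex_function h" "\<And>z. z \<in> ball 0 1 \<Longrightarrow> z * deriv h z = g z" "deriv h 0 = deriv g 0"
proof -
  have gh: "g holomorphic_on ball 0 1" and ginj: "inj_on g (ball 0 1)"
    using g by (auto simp: convex_function_def)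
  have g'nz: "deriv g z \<noteq> 0" if "z \<in> ball 0 1" for z
    using convex_function_inverse[OF g] that by metis
  \<comment> \<open>The removable singularity of \<open>g z / z\<close> is filled in;
    \<open>h\<close> will be a primitive of \<open>q\<close>.\<close>
  define q where "q z = (if z = 0 then deriv g 0 else g z / z)" for z
  have zq: "z * q z = g z" for z using g0 by (simp add: q_def)
  have qh: "q holomorphic_on ball 0 1"
    by (rule pole_theorem_open_0[OF gh open_ball, of 0]) (auto simp: q_def g0)
  obtain h where h': "\<And>z. z \<in> ball 0 1 \<Longrightarrow> (h has_field_derivative q z) (at z)"
    using holomorphic_convex_primitive'[OF convex_ball open_ball qh] by (metis at_within_open open_ball)
  have dh: "deriv h z = q z" if "z \<in> ball 0 1" for z using h'[OF that] by (rule DERIV_imp_deriv)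
  have hh: "h holomorphic_on ball 0 1"
    unfolding holomorphic_on_open[OF open_ball] using h' by blast
  \<comment> \<open>With \<open>a = x * z\<close>, the function \<open>N v = h v - h (x * v)\<close>
    satisfies \<open>v * deriv N v = g v - g (x * v)\<close>. The support property makes the real
    part of \<open>deriv N v / deriv g v\<close> nonnegative, its value \<open>1 - x\<close> at 0
    makes it positive, and \<open>Re_quotient_pos\<close> integrates this.\<close>
  have support: "Re ((h z - h a) / g z) > 0" if z: "z \<in> ball 0 1" and a: "norm a \<le> norm z" "a \<noteq> z" for z a
  proof -
    have z0: "z \<noteq> 0" using a by auto
    define x where "x = a / z"
    have x: "norm x \<le> 1" "x \<noteq> 1" "a = x * z" using a z0 by (auto simp: x_def norm_divide)
    have xb: "x * v \<in> ball 0 1" if "v \<in> ball 0 1" for v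
      using that x(1) mult_left_le_one_le[of "norm v" "norm x"] by (simp add: norm_mult)
    define N where "N v = h v - h (x * v)" for v
    have N': "(N has_field_derivative q v - q (x * v) * x) (at v)" if "v \<in> ball 0 1" for v
      unfolding N_def
      by (rule DERIV_diff[OF h'[OF that] DERIV_chain2[where f = h and g = "(*) x", OF h'[OF xb[OF that]]]])
         (auto intro!: derivative_eq_intros)
    have Nh: "N holomorphic_on ball 0 1"
      unfolding holomorphic_on_open[OF open_ball] using N' by blast
    have pos: "Re (deriv N v / deriv g v) > 0" if v: "v \<in> ball 0 1" for v
    proof (rule Re_pos_of_nonneg[where \<phi> = "\<lambda>v. deriv N v / deriv g v", OF _ _ _ v])
      show "(\<lambda>v. deriv N v / deriv g v) holomorphic_on ball 0 1"
        using g'nz by (intro holomorphic_intros holomorphic_deriv Nh gh) auto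
      have N0: "deriv N 0 / deriv g 0 = 1 - x"
        using DERIV_imp_deriv[OF N'[of 0]] g'nz[of 0] by (simp add: q_def field_simps)
      have "Re x \<noteq> 1"
      proof
        assume "Re x = 1"
        moreover from this have "Im x = 0"
          using power_mono[OF x(1), of 2] by (simp add: cmod_power2)
        ultimately show False using x(2) by (simp add: complex_eq_iff)
      qed
      then have "Re x < 1" using x(1) complex_Re_le_cmod[of x] by linarith
      then show "Re (deriv N 0 / deriv g 0) > 0" unfolding N0 by simp
      fix u :: complex assume u: "u \<in> ball 0 1"
      show "Re (deriv N u / deriv g u) \<ge> 0"
      proof (cases "u = 0")
        case True
        then show ?thesis using N0 \<open>Re x < 1\<close> by simp
      next
        case False
        have "deriv N u * u = g u - g (x * u)"
          using zq[of u] zq[of "x * u"] by (simp add: DERIV_imp_deriv[OF N'[OF u]] algebra_simps)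
        then have "deriv N u = (g u - g (x * u)) / u"
          using False by (simp add: eq_divide_eq)
        then have "deriv N u / deriv g u = (g u - g (x * u)) / (u * deriv g u)"
          by simp
        then show ?thesis using convex_function_support[OF g x(1) u False] by simp
      qed
    qed
    have "Re ((N z - N 0) / (g z - g 0)) > 0"
      by (rule Re_quotient_pos[OF g Nh pos]) (use z z0 in auto)
    then show ?thesis by (simp add: N_def g0 x(3))
  qed
  have inj: "inj_on h (ball 0 1)"
  proof (rule inj_onI, rule ccontr)
    fix a b assume ab: "a \<in> ball 0 1" "b \<in> ball 0 1" "h a = h b" "a \<noteq> b"
    show False
    proof (cases "norm a \<le> norm b")
      case True
      then show ?thesis using support[of b a] ab by simp
    next
      case False
      then show ?thesis using support[of a b] ab by simp
    qed
  qed
  have q0: "q z \<noteq> 0" if "z \<in> ball 0 1" for z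
    using holomorphic_injective_imp_regular[OF hh open_ball inj that] dh[OF that] by simp
  have "convex (h ` ball 0 1)"
    unfolding convex_alt
  proof (intro ballI allI impI)
    fix x y and t :: real
    assume xy: "x \<in> h ` ball 0 1" "y \<in> h ` ball 0 1" and t: "0 \<le> t \<and> t \<le> 1"
    from xy obtain a b where ab: "a \<in> ball 0 1" "x = h a" "b \<in> ball 0 1" "y = h b" by auto
    define m where "m = (1 - t) *\<^sub>R x + t *\<^sub>R y"
    define r where "r = max (norm a) (norm b)"
    have r: "0 \<le> r" "r < 1" "norm a \<le> r" "norm b \<le> r" using ab by (auto simp: r_def le_max_iff_disj)
    have "continuous_on (cball 0 r) (\<lambda>z. norm (h z - m))"
      using r by (intro continuous_intros holomorphic_on_imp_continuous_on holomorphic_on_subset[OF hh]) auto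
    then obtain z where z: "z \<in> cball 0 r" "\<And>v. v \<in> cball 0 r \<Longrightarrow> norm (h z - m) \<le> norm (h v - m)"
      using continuous_attains_inf[OF compact_cball, of 0 r "\<lambda>z. norm (h z - m)"] r by auto
    have zb: "z \<in> ball 0 1" using z(1) r by simp
    have "h z = m"
    proof (rule ccontr)
      assume neq: "h z \<noteq> m"
      define v where "v = (m - h z) / q z"
      have vq: "v * q z = m - h z" using q0[OF zb] by (simp add: v_def)
      \<comment> \<open>The descent direction must not leave the compact disc. Only a point on its
        boundary circle is delicate: there \<open>support\<close> shows that \<open>v\<close> points
        strictly inwards.\<close>
      have "\<exists>d>0. \<forall>s. 0 < s \<longrightarrow> s < d \<longrightarrow> z + of_real s * v \<in> cball 0 r"
      proof (cases "norm z < r")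
        case True
        have nv: "norm v > 0" using vq neq by auto
        have "norm (z + of_real s * v) \<le> r" if "0 < s" "s < (r - norm z) / norm v" for s
        proof -
          have "s * norm v \<le> r - norm z" using that nv by (simp add: field_simps)
          then show ?thesis using norm_triangle_ineq[of z "of_real s * v"] that by (simp add: norm_mult)
        qed
        then show ?thesis using True nv by (intro exI[of _ "(r - norm z) / norm v"]) auto
      next
        case False
        then have zr: "norm z = r" using z(1) by simp
        have "z \<noteq> 0"
        proof
          assume "z = 0"
          then have "a = 0" "b = 0" "z = 0" using zr r by auto
          then show False using neq ab by (simp add: m_def scaleR_conv_of_real algebra_simps)
        qed
        then have gz: "g z \<noteq> 0" using zq[of z] q0[OF zb] by auto
        have le: "Re ((h z - h c) / g z) \<ge> 0" if "norm c \<le> r" for c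
          using support[OF zb, of c] zr that by (cases "c = z") auto
        have "(h z - m) / g z = (1 - t) *\<^sub>R ((h z - h a) / g z) + t *\<^sub>R ((h z - h b) / g z)"
          using gz ab by (simp add: m_def scaleR_conv_of_real field_simps)
        then have R: "Re ((h z - m) / g z) = (1 - t) * Re ((h z - h a) / g z) + t * Re ((h z - h b) / g z)"
          by simp
        \<comment> \<open>Both terms of the convex combination are nonnegative. As
          \<open>h z \<noteq> m\<close>, some endpoint with positive weight differs from
          \<open>z\<close> and contributes strictly.\<close>
        have "Re ((h z - m) / g z) > 0"
        proof (cases "t > 0 \<and> b \<noteq> z")
          case True
          then have "t * Re ((h z - h b) / g z) > 0"
            using support[OF zb, of b] r zr by (intro mult_pos_pos) auto
          moreover have "(1 - t) * Re ((h z - h a) / g z) \<ge> 0"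
            using le r t by (intro mult_nonneg_nonneg) auto
          ultimately show ?thesis unfolding R by linarith
        next
          case False
          have "t \<noteq> 1" using False neq ab(4) by (auto simp: m_def)
          then have "t < 1" using t by simp
          have "a \<noteq> z"
            using False neq ab t by (auto simp: m_def scaleR_conv_of_real algebra_simps)
          then have "(1 - t) * Re ((h z - h a) / g z) > 0"
            using \<open>t < 1\<close> support[OF zb, of a] r zr by (intro mult_pos_pos) auto
          moreover have "t * Re ((h z - h b) / g z) \<ge> 0"
            using le r t by (intro mult_nonneg_nonneg) auto
          ultimately show ?thesis unfolding R by linarith
        qed
        moreover have "(h z - m) / g z = - (v / z)"
          using zq[of z, symmetric] vq \<open>z \<noteq> 0\<close> q0[OF zb] by (simp add: v_def field_simps)
        ultimately have "Re (v / z) < 0" by simp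
        moreover have "v \<bullet> z = Re (v / z) * (norm z)\<^sup>2"
          using \<open>z \<noteq> 0\<close> by (simp add: complex_div_cnj[of v z] Re_divide_of_real inner_complex_def)
        ultimately have vz: "v \<bullet> z < 0" using \<open>z \<noteq> 0\<close> by (simp add: mult_neg_pos)
        \<comment> \<open>The bound on \<open>s\<close> comes from expanding the squared norm: the
          negative linear term outweighs the quadratic one.\<close>
        have "norm (z + of_real s * v) \<le> r" if s: "0 < s" "s < - 2 * (v \<bullet> z) / (norm v)\<^sup>2" for s
        proof (rule power2_le_imp_le)
          have v0: "(norm v)\<^sup>2 > 0" using vz by auto
          have "s * (norm v)\<^sup>2 < - 2 * (v \<bullet> z)" using s(2) pos_less_divide_eq[OF v0] by blast
          then have "s * (s * (norm v)\<^sup>2) \<le> s * (- 2 * (v \<bullet> z))"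
            using s(1) by (intro mult_left_mono) auto
          moreover have "(norm (z + of_real s * v))\<^sup>2 = r\<^sup>2 + s * (2 * (v \<bullet> z)) + s * (s * (norm v)\<^sup>2)"
            unfolding zr[symmetric] scaleR_conv_of_real[symmetric]
            by (simp add: power2_norm_eq_inner inner_simps inner_commute algebra_simps)
          ultimately show "(norm (z + of_real s * v))\<^sup>2 \<le> r\<^sup>2" by simp
        qed (use r in simp)
        moreover have "- 2 * (v \<bullet> z) / (norm v)\<^sup>2 > 0"
          using vz by (intro divide_pos_pos) auto
        ultimately show ?thesis by (intro exI[of _ "- 2 * (v \<bullet> z) / (norm v)\<^sup>2"]) auto
      qed
      then obtain d1 where d1: "d1 > 0" "\<And>s. 0 < s \<Longrightarrow> s < d1 \<Longrightarrow> z + of_real s * v \<in> cball 0 r" by blast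
      have "((\<lambda>s::real. norm (h (z + of_real s * v) - m)) has_real_derivative - norm (h z - m)) (at 0)"
        by (rule has_derivative_norm_diff_descent[OF hh zb neq]) (simp add: dh[OF zb] vq)
      from DERIV_neg_dec_right[OF this] neq obtain d2 where d2: "d2 > 0"
        "\<And>s. 0 < s \<Longrightarrow> s < d2 \<Longrightarrow> norm (h (z + of_real s * v) - m) < norm (h z - m)"
        by auto
      define s where "s = min d1 d2 / 2"
      have "0 < s" "s < d1" "s < d2" using d1(1) d2(1) by (auto simp: s_def min_def)
      with d1(2)[of s] d2(2)[of s] z(2) show False by force
    qed
    then show "(1 - t) *\<^sub>R x + t *\<^sub>R y \<in> h ` ball 0 1" using zb unfolding m_def by (metis image_eqI)
  qed
  then have "convex_function h" using hh inj by (simp add: convex_function_def)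
  then show ?thesis
    using that[of h] dh zq by (simp add: q_def)
qed

section \<open>The class \<open>C\<^sub>2\<close>\<close>

text \<open>Otherwise the inverse would be a bounded entire function, hence constant by
  Liouville.\<close>

lemma not_surj_of_inj_on_ball:
  assumes f: "f holomorphic_on ball 0 1" "inj_on f (ball 0 1)"
  shows "f ` ball 0 1 \<noteq> (UNIV :: complex set)"
proof
  assume U: "f ` ball 0 1 = UNIV"
  obtain \<gamma> where \<gamma>: "\<gamma> holomorphic_on UNIV" "\<And>z. z \<in> ball 0 1 \<Longrightarrow> \<gamma> (f z) = z"
    using holomorphic_has_inverse[OF f(1) open_ball f(2)] unfolding U by metis
  have "\<gamma> w \<in> ball 0 1" for w
  proof -
    have "w \<in> f ` ball 0 1" using U by simp
    then show ?thesis using \<gamma>(2) by auto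
  qed
  then have "bounded (range \<gamma>)" by (intro bounded_subset[OF bounded_ball[of 0 1]]) auto
  then have "\<gamma> constant_on UNIV" using Liouville_theorem[OF \<gamma>(1)] by simp
  then have "\<gamma> (f 0) = \<gamma> (f (1/2))" by (auto simp: constant_on_def)
  then show False using \<gamma>(2)[of 0] \<gamma>(2)[of "1/2"] by simp
qed

text \<open>Fixes one comparison function \<open>g\<close> together with the quotient
  \<open>p\<close>. The value of \<open>p 0\<close> reflects that \<open>w * deriv f w\<close> has
  derivative \<open>deriv f 0 = 1\<close> at 0.\<close>

locale class_C2_pair =
  fixes f g p :: "complex \<Rightarrow> complex"
  assumes f: "f holomorphic_on ball 0 1" "f 0 = 0" "deriv f 0 = 1"
    and g: "convex_function g" "g 0 = 0" "Re (deriv g 0) > 0"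
    and p: "p holomorphic_on ball 0 1" "\<And>z. z \<in> ball 0 1 \<Longrightarrow> Re (p z) > 0" "p 0 = inverse (deriv g 0)"
    and F: "(\<lambda>w. w * deriv f w) holomorphic_on ball 0 1"
      "\<And>z. z \<in> ball 0 1 \<Longrightarrow> deriv (\<lambda>w. w * deriv f w) z = deriv g z * p z"

lemma class_C2_pair_exists:
  assumes "f \<in> class_C2"
  obtains g p where "class_C2_pair f g p"
proof -
  from assms obtain g where f: "f holomorphic_on ball 0 1" "f 0 = 0" "deriv f 0 = 1"
    and g: "convex_function g" "g 0 = 0" "Re (deriv g 0) > 0"
    and pos: "\<And>z. z \<in> ball 0 1 \<Longrightarrow> Re (deriv (\<lambda>w. w * deriv f w) z / deriv g z) > 0"
    unfolding class_C2_def by auto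
  have gh: "g holomorphic_on ball 0 1" using g(1) by (simp add: convex_function_def)
  have g'nz: "deriv g z \<noteq> 0" if "z \<in> ball 0 1" for z
    using convex_function_inverse[OF g(1)] that by metis
  have f'h: "deriv f holomorphic_on ball 0 1" by (intro holomorphic_deriv f) auto
  have Fh: "(\<lambda>w. w * deriv f w) holomorphic_on ball 0 1"
    by (intro holomorphic_intros f'h)
  have "((\<lambda>w. w * deriv f w) has_field_derivative 1 * deriv f 0 + deriv (deriv f) 0 * 0) (at 0)"
    using holomorphic_derivI[OF f'h open_ball, of 0] by (intro DERIV_mult DERIV_ident) simp
  then have F'0: "deriv (\<lambda>w. w * deriv f w) 0 = 1" using f(3) by (simp add: DERIV_imp_deriv)
  define p where "p z = deriv (\<lambda>w. w * deriv f w) z / deriv g z" for z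
  have "class_C2_pair f g p"
  proof (unfold_locales; (fact f g Fh)?)
    show "p holomorphic_on ball 0 1"
      unfolding p_def using g'nz by (intro holomorphic_intros holomorphic_deriv Fh gh) auto
    show "Re (p z) > 0" if "z \<in> ball 0 1" for z unfolding p_def by (rule pos[OF that])
    show "p 0 = inverse (deriv g 0)" by (simp add: p_def F'0 inverse_eq_divide)
    show "deriv (\<lambda>w. w * deriv f w) z = deriv g z * p z" if "z \<in> ball 0 1" for z
      using g'nz[OF that] by (simp add: p_def)
  qed
  then show ?thesis by (rule that)
qed

context class_C2_pair
begin

lemma deriv_g_nonzero: "z \<in> ball 0 1 \<Longrightarrow> deriv g z \<noteq> 0"
  using convex_function_inverse[OF g(1)] by metis

text \<open>\<open>Re_quotient_pos\<close> is used twice. First it gives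
  \<open>z * deriv f z / g z\<close> positive real part; this quotient is
  \<open>deriv f z / deriv h z\<close> for the Alexander transform \<open>h\<close> of
  \<open>g\<close>. As \<open>h\<close> is convex, a second use separates the values of
  \<open>f\<close>.\<close>

lemma inj_on_ball:
  shows "inj_on f (ball 0 1)"
proof -
  obtain h where h: "convex_function h" "\<And>z. z \<in> ball 0 1 \<Longrightarrow> z * deriv h z = g z" "deriv h 0 = deriv g 0"
    using convex_function_Alexander[OF g(1,2)] by metis
  have pos: "Re (deriv f z / deriv h z) > 0" if z: "z \<in> ball 0 1" for z
  proof (cases "z = 0")
    case True
    then show ?thesis using p(2)[of 0] p(3) f(3) h(3) by (simp add: inverse_eq_divide)
  next
    case False
    have "Re ((z * deriv f z - 0 * deriv f 0) / (g z - g 0)) > 0"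
      by (rule Re_quotient_pos[OF g(1) F(1)]) (use False z p(2) F(2) deriv_g_nonzero in auto)
    then show ?thesis using False g(2) by (simp flip: h(2)[OF z])
  qed
  show ?thesis
  proof (rule inj_onI, rule ccontr)
    fix x y assume xy: "x \<in> ball 0 1" "y \<in> ball 0 1" "f x = f y" "x \<noteq> y"
    then show False using Re_quotient_pos[OF h(1) f(1) pos xy(1,2,4)] by simp
  qed
qed

text \<open>If \<open>z * deriv f z\<close> were too small, the covering argument would give it a
  second preimage \<open>u\<close> with \<open>norm u < norm z\<close>, contradicting injectivity of
  \<open>w * deriv f w\<close>. Here \<open>K\<close> is the primitive of the lower bound
  \<open>k\<close>.\<close>

lemma deriv_lower:
  assumes z: "z \<in> ball 0 1"
  shows "norm (deriv f z) \<ge> 1 / (1 + norm z)\<^sup>2"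
proof (cases "z = 0")
  case True
  then show ?thesis using f(3) by simp
next
  case False
  define K where "K r = r / (1 + r)\<^sup>2" for r :: real
  define k where "k r = (1 - r) / (1 + r)^3" for r :: real
  have lower: "k (norm v) \<le> norm (deriv (\<lambda>w. w * deriv f w) v)" if v: "v \<in> ball 0 1" for v
  proof -
    have 0: "norm v < 1" using v by simp
    have "1 - norm v = norm (deriv g 0) * (norm (p 0) * (1 - norm v))"
      using deriv_g_nonzero[of 0] by (simp add: p(3) norm_inverse)
    also have "\<dots> \<le> (norm (deriv g v) * (1 + norm v)\<^sup>2) * (norm (p v) * (1 + norm v))"
      using 0 by (intro mult_mono convex_function_deriv_lower[OF g(1) v] Re_pos_lower_bound[OF p(1,2) v]) auto
    also have "\<dots> = norm (deriv g v * p v) * (1 + norm v)^3"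
      by (simp add: norm_mult power2_eq_square power3_eq_cube)
    finally show ?thesis
      unfolding k_def F(2)[OF v] by (simp add: divide_le_eq zero_less_power add_pos_nonneg)
  qed
  have "norm (z * deriv f z) \<ge> K (norm z)"
  proof (rule ccontr)
    assume "\<not> ?thesis"
    then have less: "norm (z * deriv f z) < K (norm z)" by simp
    obtain u where u: "norm u < norm z" "u * deriv f u = z * deriv f z"
    proof (rule covering_radius[OF F(1), of K k "norm z"])
      fix r :: real assume r: "0 \<le> r" "r < 1"
      have "1 * (1 + r)\<^sup>2 - r * (2 * (1 + r)) = (1 + r) * (1 - r)"
        by (simp add: power2_eq_square algebra_simps)
      then have eq: "(1 * (1 + r)\<^sup>2 - r * (2 * (1 + r))) / ((1 + r)\<^sup>2 * (1 + r)\<^sup>2) = k r"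
        using r by (simp add: k_def power2_eq_square power3_eq_cube)
      have "((\<lambda>r. (1 + r)\<^sup>2) has_real_derivative 2 * (1 + r)) (at r)"
        by (auto intro!: derivative_eq_intros)
      then show "(K has_real_derivative k r) (at r)"
        unfolding K_def eq[symmetric] using r by (intro DERIV_divide DERIV_ident) auto
      show "k r > 0" using r by (simp add: k_def)
    qed (use z False lower less in \<open>auto simp: K_def[of 0]\<close>)
    then have "Re ((z * deriv f z - u * deriv f u) / (g z - g u)) > 0"
      using z deriv_g_nonzero p(2) F(2) by (intro Re_quotient_pos[OF g(1) F(1)]) auto
    then show False using u(2) by simp
  qed
  then have "norm z * (1 / (1 + norm z)\<^sup>2) \<le> norm z * norm (deriv f z)"
    by (simp add: K_def norm_mult)
  then show ?thesis by (rule mult_left_le_imp_le) (use False in simp)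
qed

lemma covers_half_disc:
  shows "ball 0 (1/2) \<subseteq> f ` ball 0 1"
proof
  fix w :: complex assume "w \<in> ball 0 (1/2)"
  then have w: "norm w < 1/2" by simp
  \<comment> \<open>The midpoint of 1 and \<open>norm w / (1 - norm w)\<close>, the radius at which
    \<open>\<rho> / (1 + \<rho>)\<close> equals \<open>norm w\<close>.\<close>
  define \<rho> where "\<rho> = 1 / (2 * (1 - norm w))"
  have \<rho>: "0 < \<rho>" "\<rho> < 1" using w by (auto simp: \<rho>_def field_simps)
  have less: "norm w < \<rho> / (1 + \<rho>)"
  proof -
    have "1 + \<rho> = (3 - 2 * norm w) / (2 * (1 - norm w))" using w by (simp add: \<rho>_def field_simps)
    then have eq: "\<rho> / (1 + \<rho>) = 1 / (3 - 2 * norm w)" using w by (simp add: \<rho>_def)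
    have "(1 - 2 * norm w) * (1 - norm w) > 0" using w by (intro mult_pos_pos) auto
    then have "norm w * (3 - 2 * norm w) < 1" by (simp add: algebra_simps)
    then show ?thesis unfolding eq using w by (simp add: less_divide_eq)
  qed
  obtain z where "norm z < \<rho>" "f z = w"
  proof (rule covering_radius[OF f(1,2), of "\<lambda>r. r / (1 + r)" "\<lambda>r. 1 / (1 + r)\<^sup>2" \<rho>])
    fix r :: real assume r: "0 \<le> r" "r < 1"
    then show "((\<lambda>r. r / (1 + r)) has_real_derivative 1 / (1 + r)\<^sup>2) (at r)"
      by (auto intro!: derivative_eq_intros simp: power2_eq_square)
    show "1 / (1 + r)\<^sup>2 > 0" using r by simp
  qed (use less \<rho> deriv_lower in auto)
  then show "w \<in> f ` ball 0 1" using \<rho> by auto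
qed

text \<open>The range is open, so its boundary points lie outside it and hence outside the covered
  half disc. Nonemptiness of the boundary matters because \<open>infdist\<close> to the empty set is
  0.\<close>

lemma infdist_frontier:
  shows "1/2 \<le> infdist (f 0) (frontier (f ` ball 0 1))"
proof -
  have op: "open (f ` ball 0 1)"
    by (rule open_mapping_thm3[OF f(1) open_ball inj_on_ball])
  have ne: "frontier (f ` ball 0 1) \<noteq> {}"
    using not_surj_of_inj_on_ball[OF f(1) inj_on_ball] by (auto simp: frontier_eq_empty)
  show ?thesis
    unfolding infdist_notempty[OF ne]
  proof (rule cINF_greatest[OF ne])
    fix w assume "w \<in> frontier (f ` ball 0 1)"
    then have "w \<notin> f ` ball 0 1" using op by (simp add: frontier_def interior_open)
    then have "w \<notin> ball 0 (1/2)" using covers_half_disc by blast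
    then show "1/2 \<le> dist (f 0) w" using f(2) by simp
  qed
qed

lemma coeff_bound:
  assumes A: "f has_fps_expansion A"
  shows "norm (fps_nth A n) \<le> 1"
proof (cases n)
  case 0
  then show ?thesis
    using f(2) has_fps_expansion_imp_0_eq_fps_nth_0[OF A] by simp
next
  case (Suc n)
  define b where "b = deriv g 0"
  have b: "b \<noteq> 0" using g(3) by (auto simp: b_def)
  define G where "G = fps_expansion g 0"
  define P where "P = fps_expansion p 0"
  have G: "g has_fps_expansion G"
    unfolding G_def using g(1) by (intro has_fps_expansion_fps_expansion[of "ball 0 1"]) (auto simp: convex_function_def)
  have P: "p has_fps_expansion P"
    unfolding P_def using p(1) by (intro has_fps_expansion_fps_expansion[of "ball 0 1"]) auto
  have L: "deriv (\<lambda>w. w * deriv f w) has_fps_expansion fps_deriv (fps_X * fps_deriv A)"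
    by (intro fps_expansion_intros A)
  have R: "(\<lambda>z. deriv g z * p z) has_fps_expansion fps_deriv G * P"
    by (intro fps_expansion_intros G P)
  have "deriv (\<lambda>w. w * deriv f w) has_fps_expansion fps_deriv G * P"
    by (subst has_fps_expansion_cong[OF _ refl, of _ "\<lambda>z. deriv g z * p z"])
       (use R F in \<open>auto intro!: eventually_nhds_in_open[THEN eventually_mono, of "ball 0 1"]\<close>)
  then have "fps_deriv (fps_X * fps_deriv A) = fps_deriv G * P"
    by (rule fps_expansion_unique_complex[OF L])
  moreover have "fps_nth (fps_deriv (fps_X * fps_deriv A)) n = of_nat (Suc n) * of_nat (Suc n) * fps_nth A (Suc n)"
    unfolding fps_deriv_nth by simp
  moreover have "fps_nth (fps_deriv G * P) n
      = (\<Sum>i=0..n. of_nat (Suc i) * fps_nth G (Suc i) * fps_nth P (n - i))"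
    unfolding fps_mult_nth by simp
  \<comment> \<open>The index of the coefficient is now \<open>Suc n\<close>, the convolution being
    read at \<open>n\<close>. With the factors \<open>norm b\<close> cancelling, the weights are at
    most 1 for \<open>i = n\<close> and 2 otherwise, and the sum is exactly the square of
    \<open>Suc n\<close>.\<close>
  ultimately have eq: "of_nat (Suc n) * of_nat (Suc n) * fps_nth A (Suc n)
      = (\<Sum>i=0..n. of_nat (Suc i) * fps_nth G (Suc i) * fps_nth P (n - i))"
    by simp
  have Gb: "norm (fps_nth G (Suc i)) \<le> norm b" for i
    unfolding b_def by (rule convex_function_coeff_bound[OF g(1) G]) simp
  have P0: "norm b * norm (fps_nth P 0) = 1"
  proof -
    have "fps_nth P 0 = inverse b"
      using has_fps_expansion_imp_0_eq_fps_nth_0[OF P] p(3) by (simp add: b_def)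
    then show ?thesis using b by (simp add: norm_inverse)
  qed
  have Pb: "norm b * norm (fps_nth P j) \<le> 2" if "j > 0" for j
  proof -
    have "norm (fps_nth P j) \<le> 2 * Re (p 0)" by (rule Re_pos_coeff_bound[OF p(1,2) P that])
    also have "Re (p 0) \<le> inverse (norm b)"
      using complex_Re_le_cmod[of "p 0"] by (simp add: p(3) b_def norm_inverse)
    finally have "norm (fps_nth P j) \<le> 2 * inverse (norm b)" by simp
    then have "norm b * norm (fps_nth P j) \<le> norm b * (2 * inverse (norm b))"
      by (intro mult_left_mono) auto
    then show ?thesis using b by (simp add: field_simps)
  qed
  have "real (Suc n) * real (Suc n) * norm (fps_nth A (Suc n))
      = norm (of_nat (Suc n) * of_nat (Suc n) * fps_nth A (Suc n))"
    by (simp only: norm_mult norm_of_nat)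
  also have "\<dots> \<le> (\<Sum>i=0..n. norm (of_nat (Suc i) * fps_nth G (Suc i) * fps_nth P (n - i)))"
    unfolding eq by (rule norm_sum)
  also have "\<dots> \<le> (\<Sum>i=0..n. real (Suc i) * (if i = n then 1 else 2))"
  proof (rule sum_mono)
    fix i assume i: "i \<in> {0..n}"
    have "norm (fps_nth G (Suc i)) * norm (fps_nth P (n - i)) \<le> norm b * norm (fps_nth P (n - i))"
      by (intro mult_right_mono Gb) auto
    also have "\<dots> \<le> (if i = n then 1 else 2)" using P0 Pb[of "n - i"] i by auto
    finally have "real (Suc i) * (norm (fps_nth G (Suc i)) * norm (fps_nth P (n - i)))
        \<le> real (Suc i) * (if i = n then 1 else 2)"
      by (intro mult_left_mono) auto
    then show "norm (of_nat (Suc i) * fps_nth G (Suc i) * fps_nth P (n - i)) \<le> real (Suc i) * (if i = n then 1 else 2)"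
      by (simp only: norm_mult norm_of_nat mult.assoc)
  qed
  also have "\<dots> = (\<Sum>i<n. real (Suc i) * 2) + real (Suc n)"
  proof -
    have "{0..n} = insert n {..<n}" by auto
    then show ?thesis by simp
  qed
  also have "(\<Sum>i<n. real (Suc i) * 2) = real n * real (Suc n)"
    by (induction n) (auto simp: algebra_simps)
  also have "real n * real (Suc n) + real (Suc n) = real (Suc n) * real (Suc n)"
    by (simp add: algebra_simps)
  finally have "(real (Suc n) * real (Suc n)) * norm (fps_nth A (Suc n)) \<le> (real (Suc n) * real (Suc n)) * 1"
    by simp
  then show ?thesis unfolding Suc by (simp only: mult_le_cancel_left_pos of_nat_0_less_iff mult_pos_pos zero_less_Suc)
qed

end

section \<open>Bohr's inequality\<close>

text \<open>All coefficients have modulus at most 1, so both summands are dominated by geometric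
  series; the one for \<open>f z\<close> starts at index 1 because \<open>f 0 = 0\<close>.\<close>

lemma class_C2_bohr_sum:
  assumes f: "f \<in> class_C2" and z: "z \<in> ball 0 1"
  shows "norm (f z) + (\<Sum>n. norm (taylor_coeff f (n + N) * z ^ (n + N)))
    \<le> (norm z + norm z ^ N) / (1 - norm z)"
proof -
  define r where "r = norm z"
  have r: "0 \<le> r" "r < 1" using z by (auto simp: r_def)
  define A where "A = fps_expansion f 0"
  obtain g p where "class_C2_pair f g p" using class_C2_pair_exists[OF f] .
  then interpret class_C2_pair f g p .
  have A: "f has_fps_expansion A"
    unfolding A_def using f by (intro has_fps_expansion_fps_expansion[of "ball 0 1"]) (auto simp: class_C2_def)
  have A0: "fps_nth A 0 = 0"
    using has_fps_expansion_imp_0_eq_fps_nth_0[OF A] f by (simp add: class_C2_def)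
  have le: "norm (fps_nth A n * z ^ n) \<le> r ^ n" for n
    using mult_right_mono[OF coeff_bound[OF A], of "r ^ n" n] r
    by (simp add: norm_mult norm_power r_def)
  have geom: "(\<lambda>n. r ^ (n + m)) sums (r ^ m / (1 - r))" for m
    using sums_mult2[OF geometric_sums[of r], of "r ^ m"] r by (simp add: power_add)
  have summ: "summable (\<lambda>n. norm (fps_nth A (n + m) * z ^ (n + m)))" for m
    by (rule summable_comparison_test[OF _ sums_summable[OF geom[of m]]]) (use le in auto)
  have tail: "(\<Sum>n. norm (fps_nth A (n + m) * z ^ (n + m))) \<le> r ^ m / (1 - r)" for m
    using suminf_le[OF _ summ[of m] sums_summable[OF geom[of m]]] le sums_unique[OF geom[of m]] by simp
  have "(\<lambda>n. fps_nth A n * z ^ n) sums f z"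
    using holomorphic_power_series[OF f(1)] z by (simp add: A_def fps_expansion_def)
  then have "(\<lambda>n. fps_nth A (n + 1) * z ^ (n + 1)) sums f z"
    using sums_Suc_iff[of "\<lambda>n. fps_nth A n * z ^ n" "f z"] A0 by simp
  then have "f z = (\<Sum>n. fps_nth A (n + 1) * z ^ (n + 1))" by (rule sums_unique)
  then have "norm (f z) \<le> (\<Sum>n. norm (fps_nth A (n + 1) * z ^ (n + 1)))"
    using summable_norm[OF summ[of 1]] by simp
  also have "\<dots> \<le> r / (1 - r)" using tail[of 1] by simp
  finally show ?thesis
    using tail[of N] by (simp add: taylor_coeff_def A_def[symmetric] r_def[symmetric] add_divide_distrib)
qed

section \<open>Sharpness: the half-plane map\<close>

text \<open>Being nearer to 0 than to -1 means lying to the right of the perpendicular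
  bisector.\<close>

lemma norm_less_norm_1_plus_iff: "norm w < norm (1 + w) \<longleftrightarrow> Re w > - 1/2"
proof -
  have "norm w < norm (1 + w) \<longleftrightarrow> (norm w)\<^sup>2 < (norm (1 + w))\<^sup>2"
    by (simp add: power_mono_iff flip: not_le)
  also have "(norm (1 + w))\<^sup>2 = (norm w)\<^sup>2 + (2 * Re w + 1)"
    unfolding cmod_power2 by (simp add: power2_eq_square algebra_simps)
  finally show ?thesis by auto
qed

lemma image_half_plane_map: "(\<lambda>z::complex. z / (1 - z)) ` ball 0 1 = {w. Re w > - 1/2}"
proof (intro set_eqI iffI)
  fix w :: complex assume "w \<in> (\<lambda>z. z / (1 - z)) ` ball 0 1"
  then obtain z where z: "norm z < 1" "w = z / (1 - z)" by auto
  then have "1 - z \<noteq> 0" by auto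
  then have w: "1 + w = 1 / (1 - z)" "w = z * (1 / (1 - z))" using z by (auto simp: field_simps)
  have "norm w = norm z * norm (1 + w)" by (subst w(2), subst w(1)) (rule norm_mult)
  also have "\<dots> < 1 * norm (1 + w)"
    using z(1) \<open>1 - z \<noteq> 0\<close> by (intro mult_strict_right_mono) (auto simp: w(1))
  finally show "w \<in> {w. Re w > - 1/2}" using norm_less_norm_1_plus_iff[of w] by simp
next
  fix w :: complex assume "w \<in> {w. Re w > - 1/2}"
  then have w: "norm w < norm (1 + w)" using norm_less_norm_1_plus_iff[of w] by simp
  then have nz: "1 + w \<noteq> 0" by auto
  have "1 - w / (1 + w) = 1 / (1 + w)" using nz by (simp add: field_simps)
  then have "w = (w / (1 + w)) / (1 - w / (1 + w))" using nz by simp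
  moreover have "w / (1 + w) \<in> ball 0 1" using w nz by (simp add: norm_divide)
  ultimately show "w \<in> (\<lambda>z. z / (1 - z)) ` ball 0 1" by (rule image_eqI)
qed

text \<open>The map serves as its own comparison function: the quotient equals
  \<open>1 + 2 * e z\<close>, whose real part is positive because the range is a half-plane.\<close>

lemma half_plane_map_in_class_C2: "(\<lambda>z. z / (1 - z)) \<in> class_C2"
proof -
  define e :: "complex \<Rightarrow> complex" where "e = (\<lambda>z. z / (1 - z))"
  have nz: "1 - z \<noteq> 0" if "z \<in> ball 0 1" for z :: complex using that by auto
  have e': "deriv e z = 1 / (1 - z)\<^sup>2" if "z \<in> ball 0 1" for z
    unfolding e_def using nz[OF that]
    by (intro DERIV_imp_deriv) (auto intro!: derivative_eq_intros simp: power2_eq_square)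
  have "convex_function e"
    unfolding convex_function_def
  proof (intro conjI)
    show "e holomorphic_on ball 0 1" unfolding e_def by (intro holomorphic_intros) auto
    show "inj_on e (ball 0 1)"
    proof (rule inj_onI)
      fix x y assume xy: "x \<in> ball 0 1" "y \<in> ball 0 1" "e x = e y"
      then have "x * (1 - y) = y * (1 - x)" using nz by (simp add: e_def frac_eq_eq)
      then show "x = y" by (simp add: algebra_simps)
    qed
    show "convex (e ` ball 0 1)" unfolding e_def image_half_plane_map by (rule convex_halfspace_Re_gt)
  qed
  moreover have "Re (deriv (\<lambda>w. w * deriv e w) z / deriv e z) > 0" if z: "z \<in> ball 0 1" for z
  proof -
    have "deriv (\<lambda>w. w * deriv e w) z = deriv (\<lambda>w. w * (1 / (1 - w)\<^sup>2)) z"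
      using e' z by (intro deriv_cong_ev eventually_nhds_in_open[THEN eventually_mono, of "ball 0 1"]) auto
    also have "\<dots> = 1 / (1 - z)\<^sup>2 * (1 + 2 * e z)"
    proof (rule DERIV_imp_deriv)
      have quot: "(0 * a\<^sup>2 - 1 * (2 * a * (- 1))) / (a\<^sup>2 * a\<^sup>2) = 2 / a ^ 3"
        and sum: "1 * (1 / a\<^sup>2) + 2 / a ^ 3 * z = 1 / a\<^sup>2 * (1 + 2 * (z / a))"
        if "a \<noteq> 0" for a :: complex
        using that by (simp_all add: power2_eq_square power3_eq_cube distrib_left)
      have "((\<lambda>w. (1 - w)\<^sup>2) has_field_derivative 2 * (1 - z) * (- 1)) (at z)"
        by (auto intro!: derivative_eq_intros)
      then have "((\<lambda>w. 1 / (1 - w)\<^sup>2) has_field_derivative 2 / (1 - z) ^ 3) (at z)"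
        unfolding quot[OF nz[OF z], symmetric] using nz[OF z] by (intro DERIV_divide DERIV_const) auto
      from DERIV_mult[OF DERIV_ident this]
      show "((\<lambda>w. w * (1 / (1 - w)\<^sup>2)) has_field_derivative 1 / (1 - z)\<^sup>2 * (1 + 2 * e z)) (at z)"
        unfolding sum[OF nz[OF z]] e_def .
    qed
    finally have "deriv (\<lambda>w. w * deriv e w) z / deriv e z = 1 + 2 * e z"
      using nz[OF z] e'[OF z] by simp
    moreover have "Re (e z) > - 1/2"
      using image_half_plane_map z unfolding e_def by blast
    ultimately show ?thesis by simp
  qed
  ultimately show ?thesis
    using e'[of 0] unfolding class_C2_def e_def[symmetric] convex_function_def by (auto simp: e_def)
qed

text \<open>At a positive real point the left-hand side is exactly
  \<open>(r + r ^ N) / (1 - r)\<close>, while the boundary point \<open>- 1/2\<close> caps the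
  distance at 1/2.\<close>

lemma half_plane_map_not_bohr:
  assumes r: "0 < r" "r < 1" "3 * r + 2 * r ^ N > 1" and N: "N > 0"
  shows "\<not> bohr_ineq N (\<lambda>z. z / (1 - z)) (of_real r)"
proof -
  define e :: "complex \<Rightarrow> complex" where "e = (\<lambda>z. z / (1 - z))"
  have "e has_fps_expansion Abs_fps (\<lambda>n. if n = 0 then 0 else 1)"
  proof (rule has_fps_expansionI)
    have "(\<lambda>n. (if n = 0 then 0 else 1) * u ^ n) sums e u" if "u \<in> ball 0 1" for u
    proof -
      have "(\<lambda>n. u * u ^ n) sums (u * (1 / (1 - u)))"
        using that by (intro sums_mult geometric_sums) simp
      then show ?thesis
        using sums_Suc_iff[of "\<lambda>n. (if n = 0 then 0 else 1) * u ^ n" "e u"] by (simp add: e_def)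
    qed
    then show "eventually (\<lambda>u. (\<lambda>n. fps_nth (Abs_fps (\<lambda>n. if n = 0 then 0 else 1)) n * u ^ n) sums e u) (nhds 0)"
      by (auto intro!: eventually_nhds_in_open[THEN eventually_mono, of "ball 0 1"])
  qed
  then have "fps_expansion e 0 = Abs_fps (\<lambda>n. if n = 0 then 0 else 1)"
    by (rule fps_expansion_eqI)
  \<comment> \<open>Since \<open>N > 0\<close>, the tail never meets the vanishing coefficient of
    index 0.\<close>
  then have t: "taylor_coeff e (n + N) = 1" for n using N by (simp add: taylor_coeff_def)
  have "(\<lambda>n. r ^ (n + N)) sums (r ^ N / (1 - r))"
    using sums_mult2[OF geometric_sums[of r], of "r ^ N"] r by (simp add: power_add)
  then have tail: "(\<Sum>n. norm (taylor_coeff e (n + N) * of_real r ^ (n + N))) = r ^ N / (1 - r)"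
    using r by (simp add: t norm_power norm_mult sums_iff)
  have "e (of_real r) = of_real (r / (1 - r))" by (simp add: e_def)
  then have er: "norm (e (of_real r)) = r / (1 - r)" using r by (simp only: norm_of_real) simp
  have "frontier {w. Re w > - 1/2} = {w. Re w = - 1/2}"
    using frontier_halfspace_gt[of "1 :: complex" "- 1/2"] by (simp add: inner_complex_def)
  then have "- 1/2 \<in> frontier (e ` ball 0 1)" by (simp add: e_def image_half_plane_map)
  then have "infdist (e 0) (frontier (e ` ball 0 1)) \<le> dist (e 0) (- 1/2)" by (rule infdist_le)
  also have "\<dots> = 1/2" by (simp add: e_def dist_norm norm_divide)
  also have "\<dots> < (r + r ^ N) / (1 - r)" using r by (simp add: field_simps)
  finally show ?thesis
    unfolding bohr_ineq_def e_def[symmetric] tail er by (simp add: add_divide_distrib)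
qed

lemma root_function_strict_mono:
  fixes r s :: real
  assumes "0 \<le> r" "r < s"
  shows "3 * r + 2 * r ^ N < 3 * s + 2 * s ^ N"
  using power_mono[of r s N] assms by simp

lemma is_root_ex1:
  assumes "N > 0"
  shows "\<exists>!r. is_root N r"
proof (rule ex_ex1I)
  have "\<exists>r\<ge>0. r \<le> 1 \<and> 3 * r + 2 * r ^ N - 1 = (0::real)"
    using assms by (intro IVT') (auto intro!: continuous_intros simp: zero_power)
  then obtain r :: real where r: "0 \<le> r" "r \<le> 1" "3 * r + 2 * r ^ N - 1 = 0" by blast
  then have "r \<noteq> 0" "r \<noteq> 1" using assms by (auto simp: zero_power)
  then show "\<exists>r. is_root N r" using r by (intro exI[of _ r]) (simp add: is_root_def)
next
  fix r s assume rs: "is_root N r" "is_root N s"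
  then show "r = s"
    using root_function_strict_mono[of r s N] root_function_strict_mono[of s r N]
    by (cases r s rule: linorder_cases) (auto simp: is_root_def)
qed

theorem theorem3p5:
  fixes N :: nat
  assumes "N \<ge> 2"
  shows "(\<exists>!r. is_root N r) \<and>
         (\<forall>f\<in>class_C2. \<forall>z. norm z \<le> r_star N \<longrightarrow> bohr_ineq N f z) \<and>
         (\<forall>R > r_star N. \<exists>f\<in>class_C2. \<exists>z\<in>ball 0 1. norm z \<le> R \<and> \<not> bohr_ineq N f z)"
proof (intro conjI ballI allI impI)
  show ex1: "\<exists>!r. is_root N r" using assms by (intro is_root_ex1) simp
  have "is_root N (r_star N)" unfolding r_star_def by (rule theI'[OF ex1])
  then have r: "0 < r_star N" "r_star N < 1" "3 * r_star N + 2 * r_star N ^ N = 1"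
    by (auto simp: is_root_def)
  show "bohr_ineq N f z" if f: "f \<in> class_C2" and z: "norm z \<le> r_star N" for f z
  proof -
    have "3 * norm z + 2 * norm z ^ N \<le> 1"
      using root_function_strict_mono[of "norm z" "r_star N" N] z r(3) by (cases "norm z = r_star N") auto
    then have "(norm z + norm z ^ N) / (1 - norm z) \<le> 1/2" using z r(2) by (simp add: field_simps)
    also obtain g p where "class_C2_pair f g p" using class_C2_pair_exists[OF f] .
    then have "1/2 \<le> infdist (f 0) (frontier (f ` ball 0 1))" by (rule class_C2_pair.infdist_frontier)
    finally have "(norm z + norm z ^ N) / (1 - norm z) \<le> infdist (f 0) (frontier (f ` ball 0 1))" .
    moreover have "z \<in> ball 0 1" using z r(2) by simp
    ultimately show ?thesis
      unfolding bohr_ineq_def using class_C2_bohr_sum[OF f] order_trans by blast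
  qed
  show "\<exists>f\<in>class_C2. \<exists>z\<in>ball 0 1. norm z \<le> R \<and> \<not> bohr_ineq N f z" if "R > r_star N" for R
  proof -
    \<comment> \<open>The minimum keeps the witness inside the unit disc even when \<open>R\<close>
      exceeds 1.\<close>
    have "r_star N < min R 1" using that r(2) by simp
    then obtain s where s: "r_star N < s" "s < min R 1" using dense by blast
    then have "3 * s + 2 * s ^ N > 1" using root_function_strict_mono[of "r_star N" s N] r by simp
    then have "\<not> bohr_ineq N (\<lambda>z. z / (1 - z)) (of_real s)"
      using s r assms by (intro half_plane_map_not_bohr) auto
    then show ?thesis
      using s r half_plane_map_in_class_C2
      by (intro bexI[of _ "\<lambda>z. z / (1 - z)"] bexI[of _ "of_real s"]) auto
  qed
qed

end
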